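(* Let $\Upsilon_1\subset\mathbb{R}^2$ be a bounded curvilinear polygonal domain with exactly one reentrant corner, located at the origin, of opening $2\theta_0=\pi/\alpha$ with $1/2<\alpha<1$, such that the two sides meeting at this corner are locally straight and, with suitably chosen axes, the tangent cone of $\Upsilon_1$ at $0$ is $\Omega=\{(r\cos\theta,r\sin\theta):r>0,\ |\theta|<\theta_0\}$. Assume that $\Upsilon_1\subset\Omega$. For $\epsilon>0$ let $\phi_\epsilon$ be the solution of $$-\Delta\phi_\epsilon=\epsilon^{-2}\mathrm{e}^{-\phi_\epsilon}\ \text{ in }\Upsilon_1,\qquad\phi_\epsilon=0\ \text{ on }\partial\Upsilon_1.$$ Then, for any $\boldsymbol{\xi}\in\Omega$, the rescaled function $v_\epsilon(\boldsymbol{\xi})=\phi_\epsilon(\epsilon\boldsymbol{\xi})$, defined for $\epsilon$ small enough, converges as $\epsilon\to0$ to $u(\boldsymbol{\xi})$, where $u$ is the minimal solution of $-\Delta\varphi=\mathrm{e}^{-\varphi}$ in $\Omega$, $\varphi=0$ on $\partial\Omega$.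
   Context: A curvilinear polygon is an open set $\mathcal{O}\subset\mathbb{R}^2$ such that for any $\boldsymbol{x}_0\in\overline{\mathcal{O}}$ and $\eta$ small enough, $\mathcal{O}\cap B(\boldsymbol{x}_0,\eta)$ is $C^2$-diffeomorphic (up to the boundary, near $\boldsymbol{x}_0$) either to $\mathbb{R}^2$ or to a sector $\{r>0,\ |\theta|<\theta_{\boldsymbol{x}_0}\}$ with $0<\theta_{\boldsymbol{x}_0}<\pi$; thus its boundary consists of smooth sides meeting at corners, without cusps or cracks. A corner of opening $2\theta_{\boldsymbol{c}}$ is reentrant if $2\theta_{\boldsymbol{c}}>\pi$. The function $\phi_\epsilon\in H^1_0(\Upsilon_1)$ is the unique variational solution. The minimal solution $u$ in $\Omega$ is $u=\sup_{R>0}u_R$, where $u_R\in H^1_0(\Omega_R)$ is the unique variational solution of $-\Delta u_R=\mathrm{e}^{-u_R}$ in $\Omega_R=\Omega\cap\{|\boldsymbol{x}|<R\}$, $u_R=0$ on $\partial\Omega_R$; it is the smallest non-negative local variational solution, i.e. the smallest non-negative $\varphi$ with $\varphi\in H^1(\mathcal{O})$ for every bounded open $\mathcal{O}\subset\Omega$, zero trace on $\partial\Omega$, and $\int_\Omega\nabla\varphi\cdot\nabla v=\int_\Omega\mathrm{e}^{-\varphi}v$ for all $v\in H^1_0(\Omega)$ with bounded support. *)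

theory Defs
  imports "HOL-Analysis.Analysis"
begin

section \<open>Sobolev spaces\<close>

text \<open>
  Members of \<open>L\<^sup>2(U)\<close>, \<open>H\<^sup>1(U)\<close> and \<open>H\<^sup>1\<^sub>0(U)\<close> are represented by total functions of which only the
  values on \<open>U\<close> matter.
\<close>

text \<open>Meaningful for open sets only, since it uses unrestricted derivatives.\<close>

primrec Ck_on :: "nat \<Rightarrow> 'a::euclidean_space set \<Rightarrow> ('a \<Rightarrow> 'b::real_normed_vector) \<Rightarrow> bool" where
  "Ck_on 0 U f \<longleftrightarrow> continuous_on U f"
| "Ck_on (Suc k) U f \<longleftrightarrow>
     (\<forall>x\<in>U. f differentiable at x) \<and>
     (\<forall>i\<in>Basis. Ck_on k U (\<lambda>x. frechet_derivative f (at x) i))"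

definition test_functions :: "'a::euclidean_space set \<Rightarrow> ('a \<Rightarrow> real) set" where
  "test_functions U =
     {\<psi>. (\<forall>k. Ck_on k UNIV \<psi>) \<and> compact (closure {x. \<psi> x \<noteq> 0}) \<and> closure {x. \<psi> x \<noteq> 0} \<subseteq> U}"

definition L2_on :: "'a::euclidean_space set \<Rightarrow> ('a \<Rightarrow> 'b::euclidean_space) set" where
  "L2_on U = {f. f \<in> borel_measurable (lebesgue_on U) \<and>
                 integrable (lebesgue_on U) (\<lambda>x. (norm (f x))\<^sup>2)}"

definition has_weak_gradient ::
  "('a::euclidean_space \<Rightarrow> real) \<Rightarrow> ('a \<Rightarrow> 'a) \<Rightarrow> 'a set \<Rightarrow> bool" where
  "has_weak_gradient f g U \<longleftrightarrow>
     (\<forall>\<psi>\<in>test_functions U. \<forall>i\<in>Basis.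
        integral\<^sup>L (lebesgue_on U) (\<lambda>x. f x * frechet_derivative \<psi> (at x) i) =
        - integral\<^sup>L (lebesgue_on U) (\<lambda>x. (g x \<bullet> i) * \<psi> x))"

definition H1 :: "'a::euclidean_space set \<Rightarrow> ('a \<Rightarrow> real) set" where
  "H1 U = {f \<in> L2_on U. \<exists>g \<in> L2_on U. has_weak_gradient f g U}"

text \<open>On \<open>H1 U\<close>, with \<open>U\<close> open, the choice is unique up to null sets.\<close>

definition weak_gradient :: "'a::euclidean_space set \<Rightarrow> ('a \<Rightarrow> real) \<Rightarrow> 'a \<Rightarrow> 'a" where
  "weak_gradient U f = (SOME g. g \<in> L2_on U \<and> has_weak_gradient f g U)"

definition H1_norm :: "'a::euclidean_space set \<Rightarrow> ('a \<Rightarrow> real) \<Rightarrow> real" where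
  "H1_norm U f = sqrt (integral\<^sup>L (lebesgue_on U) (\<lambda>x. (f x)\<^sup>2) +
                       integral\<^sup>L (lebesgue_on U) (\<lambda>x. (norm (weak_gradient U f x))\<^sup>2))"

definition H10 :: "'a::euclidean_space set \<Rightarrow> ('a \<Rightarrow> real) set" where
  "H10 U = {f \<in> H1 U. \<exists>\<psi> :: nat \<Rightarrow> 'a \<Rightarrow> real.
     (\<forall>n. \<psi> n \<in> test_functions U) \<and> (\<lambda>n. H1_norm U (\<lambda>x. f x - \<psi> n x)) \<longlonglongrightarrow> 0}"


section \<open>Solutions of the boundary value problems\<close>

text \<open>
  Variational solutions of \<open>-\<Delta>\<phi> = c e\<^sup>-\<^sup>\<phi>\<close> in \<open>U\<close>, \<open>\<phi> = 0\<close> on the boundary. The integrability conjunct only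
  says that the right-hand side is a genuine integral: the Bochner integral of a non-integrable
  function is 0 by convention.
\<close>

definition variational_solution ::
  "'a::euclidean_space set \<Rightarrow> real \<Rightarrow> ('a \<Rightarrow> real) \<Rightarrow> bool" where
  "variational_solution U c \<phi> \<longleftrightarrow>
     \<phi> \<in> H10 U \<and>
     (\<forall>v\<in>H10 U.
        integrable (lebesgue_on U) (\<lambda>x. exp (- \<phi> x) * v x) \<and>
        integral\<^sup>L (lebesgue_on U) (\<lambda>x. weak_gradient U \<phi> x \<bullet> weak_gradient U v x) =
        c * integral\<^sup>L (lebesgue_on U) (\<lambda>x. exp (- \<phi> x) * v x))"

text \<open>
  A variational solution is only determined almost everywhere. Its point values are those of the
  representative which is continuous in the open set \<open>U\<close>, provided by interior elliptic regularity.
\<close>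

definition dirichlet_solution ::
  "'a::euclidean_space set \<Rightarrow> real \<Rightarrow> ('a \<Rightarrow> real) \<Rightarrow> bool" where
  "dirichlet_solution U c \<phi> \<longleftrightarrow> variational_solution U c \<phi> \<and> continuous_on U \<phi>"

text \<open>
  The minimal solution is the supremum of the solutions \<open>w R\<close> in the truncated domains. At \<open>x\<close> only
  the radii with \<open>x\<close> in the truncated domain are relevant. The supremum is taken in the extended
  reals, so that no junk value arises for an unbounded family.
\<close>

definition minimal_solution :: "'a::euclidean_space set \<Rightarrow> ('a \<Rightarrow> real) \<Rightarrow> bool" where
  "minimal_solution U u \<longleftrightarrow>
     (\<exists>w. (\<forall>R>0. dirichlet_solution (U \<inter> ball 0 R) 1 (w R)) \<and>
          (\<forall>x\<in>U. ereal (u x) = (SUP R\<in>{norm x<..}. ereal (w R x))))"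


section \<open>Curvilinear polygons\<close>

definition sector :: "real \<Rightarrow> (real^2) set" where
  "sector \<theta> = {vector [r * cos t, r * sin t] | r t. 0 < r \<and> \<bar>t\<bar> < \<theta>}"

definition C2_diffeo ::
  "(real^2) set \<Rightarrow> (real^2) set \<Rightarrow> (real^2 \<Rightarrow> real^2) \<Rightarrow> bool" where
  "C2_diffeo V W \<Psi> \<longleftrightarrow>
     open V \<and> open W \<and> bij_betw \<Psi> V W \<and> Ck_on 2 V \<Psi> \<and> Ck_on 2 W (inv_into V \<Psi>)"

text \<open>
  The set \<open>U\<close> is straightened in the ball of radius \<open>\<eta>\<close> around \<open>x\<close> into the model cone \<open>K\<close> with apex 0.
  Working with a diffeomorphism of the whole ball expresses regularity up to the boundary.
\<close>

definition local_chart ::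
  "(real^2) set \<Rightarrow> real^2 \<Rightarrow> real \<Rightarrow> (real^2) set \<Rightarrow> (real^2 \<Rightarrow> real^2) \<Rightarrow> bool" where
  "local_chart U x \<eta> K \<Psi> \<longleftrightarrow>
     (\<exists>W. C2_diffeo (ball x \<eta>) W \<Psi> \<and> \<Psi> x = 0 \<and> \<Psi> ` (U \<inter> ball x \<eta>) = K \<inter> W)"

definition model_cones :: "(real^2) set set" where
  "model_cones = insert UNIV {sector \<theta> | \<theta>. 0 < \<theta> \<and> \<theta> < pi}"

definition curvilinear_polygon :: "(real^2) set \<Rightarrow> bool" where
  "curvilinear_polygon U \<longleftrightarrow>
     open U \<and>
     (\<forall>x\<in>closure U. \<exists>K\<in>model_cones. \<forall>\<^sub>F \<eta> in at_right 0. \<exists>\<Psi>. local_chart U x \<eta> K \<Psi>)"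

definition has_tangent_cone :: "(real^2) set \<Rightarrow> real^2 \<Rightarrow> (real^2) set \<Rightarrow> bool" where
  "has_tangent_cone U x T \<longleftrightarrow>
     (\<exists>\<eta>>0. \<exists>K\<in>model_cones. \<exists>\<Psi>. local_chart U x \<eta> K \<Psi> \<and>
        T = {w. frechet_derivative \<Psi> (at x) w \<in> K})"

text \<open>
  A diffeomorphism does not preserve angles, so the opening \<open>2\<theta>\<close> of a corner is that of its tangent
  cone, up to a linear isometry, and not that of the model sector. The value \<open>\<theta> = \<pi>/2\<close> is a
  regular boundary point.
\<close>

definition corner_with_opening :: "(real^2) set \<Rightarrow> real^2 \<Rightarrow> real \<Rightarrow> bool" where
  "corner_with_opening U c \<omega> \<longleftrightarrow>
     (\<exists>\<theta> Q. \<omega> = 2 * \<theta> \<and> 0 < \<theta> \<and> \<theta> < pi \<and> \<theta> \<noteq> pi / 2 \<and>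
        orthogonal_transformation Q \<and> has_tangent_cone U c (Q ` sector \<theta>))"

definition reentrant_corners :: "(real^2) set \<Rightarrow> (real^2) set" where
  "reentrant_corners U = {c. \<exists>\<omega>>pi. corner_with_opening U c \<omega>}"

text \<open>Near \<open>c\<close> the boundary consists of two straight segments issuing from \<open>c\<close>.\<close>

definition sides_locally_straight :: "(real^2) set \<Rightarrow> real^2 \<Rightarrow> bool" where
  "sides_locally_straight U c \<longleftrightarrow>
     (\<exists>\<rho>>0. \<exists>a b. norm a = 1 \<and> norm b = 1 \<and> a \<noteq> b \<and>
        frontier U \<inter> ball c \<rho> = {c + t *\<^sub>R d | t d. 0 \<le> t \<and> t < \<rho> \<and> d \<in> {a, b}})"

end

(*
  By rescaling, v_eps solves the problem with coefficient 1 in the dilated domain Y/eps. Since the sides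
  are straight near the origin, Y/eps lies between the sector truncated at radius rho/eps and the
  sector truncated at radius D/eps. Solutions increase with the domain, so v_eps is squeezed between the
  solution in the smaller truncated sector, which increases to u, and u itself.

  For the comparison of solutions f1 in U and f2 in V, U contained in V, the positive part of f1 - f2
  is replaced by S (f1 - f2 - d) with a smooth S that vanishes on the negative half-line. If psi_n and
  eta_n are test functions approximating f1 and f2, then S (psi_n - eta_n - d - S_d (- eta_n)) is
  again a test function of U, because S_d t >= t - d. Thus no regularization by convolution is needed.
*)

theory Submission
  imports Defs
begin

subsection \<open>Smooth functions\<close>

text \<open>All functions are extended by zero to the whole space, so that functions living on
  different domains can be subtracted and tested together. \<open>H10_limit\<close> says that a pair
  (f, g) is an L2 limit of test functions together with their classical gradients; weak gradients
  enter only in the translation from \<open>H10\<close>, where their uniqueness almost everywhere is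
  essential because \<open>weak_gradient\<close> is a choice. The obstacle in the comparison is
  twofold: the positive part of a difference of test functions is not smooth, and it leaves the
  smaller domain wherever the approximation of f2 is negative. Replacing the positive part by
  \<open>soft 1\<close> cures the first, the shift d together with \<open>soft d\<close> the second;
  d is sent to 0 only after f1 <= f2 + d is known. No Poincare inequality is involved: strict
  monotonicity of exp (-t) alone forces the test function to vanish. The comparison holds almost
  everywhere, whereas the claim concerns a fixed point \<xi>; continuity of the representatives
  closes this gap.\<close>

definition partial :: "('a::euclidean_space \<Rightarrow> real) \<Rightarrow> 'a \<Rightarrow> 'a \<Rightarrow> real" where
  "partial f i x = frechet_derivative f (at x) i"

definition smooth :: "('a::euclidean_space \<Rightarrow> real) \<Rightarrow> bool" where
  "smooth f \<longleftrightarrow> (\<forall>k. Ck_on k UNIV f)"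

lemma partial_eq: "(f has_derivative f') (at x) \<Longrightarrow> partial f i x = f' i"
  unfolding partial_def by (metis frechet_derivative_at)

lemma Ck_on_Suc_UNIV:
  "Ck_on (Suc k) UNIV f \<longleftrightarrow> (\<forall>x. f differentiable at x) \<and> (\<forall>i\<in>Basis. Ck_on k UNIV (partial f i))"
  unfolding partial_def by simp

lemma Ck_on_SucI:
  fixes f :: "'a::euclidean_space \<Rightarrow> real"
  assumes "\<And>x. (f has_derivative f' x) (at x)"
    and "\<And>i. i \<in> Basis \<Longrightarrow> Ck_on k UNIV (\<lambda>x. f' x i)"
  shows "Ck_on (Suc k) UNIV f"
proof -
  have "partial f i = (\<lambda>x. f' x i)" for i
    using partial_eq[OF assms(1)] by blast
  then show ?thesis
    using assms unfolding Ck_on_Suc_UNIV by (auto simp: differentiable_def)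
qed

text \<open>At order 0 this is continuity of a differentiable function. The product rule relies on
  it, since f and g reappear there undifferentiated.\<close>

lemma Ck_on_UNIV_Suc_D:
  fixes f :: "'a::euclidean_space \<Rightarrow> real"
  shows "Ck_on (Suc k) UNIV f \<Longrightarrow> Ck_on k UNIV f"
proof (induction k arbitrary: f)
  case 0
  then show ?case
    by (auto simp: continuous_on_eq_continuous_at differentiable_imp_continuous_within)
next
  case (Suc k)
  then show ?case unfolding Ck_on_Suc_UNIV by auto
qed

lemma has_derivative_partial:
  assumes "Ck_on (Suc k) UNIV f"
  shows "(f has_derivative frechet_derivative f (at x)) (at x)"
  using assms by (simp add: frechet_derivative_works)

lemma Ck_on_UNIV_const: "Ck_on k UNIV (\<lambda>x. c::real)"
proof (induction k arbitrary: c)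
  case (Suc k)
  show ?case
    by (rule Ck_on_SucI[where f'="\<lambda>x i. 0"]) (use Suc in auto)
qed simp

lemma Ck_on_UNIV_inner: "Ck_on k UNIV (\<lambda>x. x \<bullet> j)"
proof (cases k)
  case (Suc k)
  have "Ck_on (Suc k) UNIV (\<lambda>x. x \<bullet> j)"
    by (rule Ck_on_SucI[where f'="\<lambda>x i. i \<bullet> j"])
       (auto intro!: derivative_eq_intros Ck_on_UNIV_const)
  then show ?thesis using Suc by simp
qed (auto intro!: continuous_intros)

lemma Ck_on_UNIV_add:
  fixes f g :: "'a::euclidean_space \<Rightarrow> real"
  shows "Ck_on k UNIV f \<Longrightarrow> Ck_on k UNIV g \<Longrightarrow> Ck_on k UNIV (\<lambda>x. f x + g x)"
proof (induction k arbitrary: f g)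
  case 0
  then show ?case by (auto intro!: continuous_intros)
next
  case (Suc k)
  show ?case
    by (rule Ck_on_SucI, rule has_derivative_add[OF has_derivative_partial[OF Suc.prems(1)]
          has_derivative_partial[OF Suc.prems(2)]])
       (use Suc in auto)
qed

lemma Ck_on_UNIV_mult:
  fixes f g :: "'a::euclidean_space \<Rightarrow> real"
  shows "Ck_on k UNIV f \<Longrightarrow> Ck_on k UNIV g \<Longrightarrow> Ck_on k UNIV (\<lambda>x. f x * g x)"
proof (induction k arbitrary: f g)
  case 0
  then show ?case by (auto intro!: continuous_intros)
next
  case (Suc k)
  show ?case
    by (rule Ck_on_SucI, rule has_derivative_mult[OF has_derivative_partial[OF Suc.prems(1)]
          has_derivative_partial[OF Suc.prems(2)]])
       (use Suc Ck_on_UNIV_Suc_D in \<open>auto intro!: Ck_on_UNIV_add Suc.IH\<close>)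
qed

lemma Ck_on_UNIV_scaleR:
  fixes f :: "'a::euclidean_space \<Rightarrow> real"
  shows "Ck_on k UNIV f \<Longrightarrow> Ck_on k UNIV (\<lambda>x. f (s *\<^sub>R x))"
proof (induction k arbitrary: f)
  case 0
  then have "continuous_on UNIV f" by simp
  then have "continuous_on UNIV (\<lambda>x. f (s *\<^sub>R x))"
    by (rule continuous_on_compose2) (auto intro!: continuous_intros)
  then show ?case by simp
next
  case (Suc k)
  show ?case
  proof (rule Ck_on_SucI)
    show "((\<lambda>x. f (s *\<^sub>R x)) has_derivative (\<lambda>i. frechet_derivative f (at (s *\<^sub>R x)) (s *\<^sub>R i))) (at x)" for x
      by (rule has_derivative_compose[where g=f and f="\<lambda>x. s *\<^sub>R x", OF _ has_derivative_partial[OF Suc.prems]])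
         (auto intro!: derivative_eq_intros)
    have lin: "frechet_derivative f (at y) (s *\<^sub>R i) = s * frechet_derivative f (at y) i" for y i
      using has_derivative_partial[OF Suc.prems] has_derivative_linear linear_cmul
      by (metis real_scaleR_def)
    show "Ck_on k UNIV (\<lambda>x. frechet_derivative f (at (s *\<^sub>R x)) (s *\<^sub>R i))" if "i \<in> Basis" for i
      unfolding lin by (rule Ck_on_UNIV_mult[OF Ck_on_UNIV_const])
        (use that Suc in \<open>auto simp: partial_def\<close>)
  qed
qed

lemma smooth_const: "smooth (\<lambda>x. c)"
  and smooth_inner: "smooth (\<lambda>x. x \<bullet> j)"
  by (simp_all add: smooth_def Ck_on_UNIV_const Ck_on_UNIV_inner del: Ck_on.simps)

lemma smooth_add: "smooth f \<Longrightarrow> smooth g \<Longrightarrow> smooth (\<lambda>x. f x + g x)"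
  and smooth_mult: "smooth f \<Longrightarrow> smooth g \<Longrightarrow> smooth (\<lambda>x. f x * g x)"
  and smooth_scaleR: "smooth f \<Longrightarrow> smooth (\<lambda>x. f (s *\<^sub>R x))"
  by (simp_all add: smooth_def Ck_on_UNIV_add Ck_on_UNIV_mult Ck_on_UNIV_scaleR del: Ck_on.simps)

lemma smooth_uminus: "smooth f \<Longrightarrow> smooth (\<lambda>x. - f x)"
  using smooth_mult[OF smooth_const[of "-1"], of f] by simp

lemma smooth_diff: "smooth f \<Longrightarrow> smooth g \<Longrightarrow> smooth (\<lambda>x. f x - g x)"
  using smooth_add[OF _ smooth_uminus, of f g] by simp

lemma smooth_prod: "(\<And>i. i \<in> I \<Longrightarrow> smooth (f i)) \<Longrightarrow> smooth (\<lambda>x. \<Prod>i\<in>I. f i x)"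
  by (induction I rule: infinite_finite_induct) (auto intro!: smooth_const smooth_mult)

lemma smooth_partial: "smooth f \<Longrightarrow> i \<in> Basis \<Longrightarrow> smooth (partial f i)"
  by (metis Ck_on_Suc_UNIV smooth_def)

lemma smooth_has_derivative:
  "smooth f \<Longrightarrow> (f has_derivative frechet_derivative f (at x)) (at x)"
  unfolding smooth_def by (blast intro: has_derivative_partial)

lemma smooth_continuous: "smooth f \<Longrightarrow> continuous_on S f"
  unfolding smooth_def by (metis Ck_on.simps(1) continuous_on_subset subset_UNIV)

subsection \<open>The flat exponential\<close>

text \<open>The classical function exp (-c / t), flat at 0. The index j for the power in the
  denominator makes the family closed under differentiation, so that one induction reaches all
  orders.\<close>

definition flat :: "real \<Rightarrow> nat \<Rightarrow> real \<Rightarrow> real" where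
  "flat c j t = (if t > 0 then exp (- c / t) / t ^ j else 0)"

text \<open>A single Taylor term, while the other terms and the remainder are non-negative. With x =
  c / t it gives the decay of exp (-c / t) at 0.\<close>

lemma power_over_fact_le_exp:
  fixes x :: real
  assumes "x \<ge> 0"
  shows "x ^ n / fact n \<le> exp x"
proof -
  obtain t where t: "exp x = (\<Sum>m<Suc n. x ^ m / fact m) + exp t / fact (Suc n) * x ^ Suc n"
    using Maclaurin_exp_le[of x "Suc n"] by blast
  have "x ^ n / fact n \<le> (\<Sum>m<Suc n. x ^ m / fact m)"
    using assms by (simp add: sum_nonneg)
  also have "\<dots> \<le> exp x" unfolding t using assms by simp
  finally show ?thesis .
qed

lemma flat_nonneg: "0 \<le> flat c j t"
  by (simp add: flat_def)

lemma flat_le: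
  assumes "c > 0"
  obtains B where "B \<ge> 0" "\<And>t. t > 0 \<Longrightarrow> flat c j t \<le> B * t\<^sup>2"
proof
  \<comment> \<open>Two powers more than the denominator, so that t ^ m / t ^ j is quadratic; this
    is what makes the difference quotient at 0 tend to 0.\<close>
  define m :: nat where "m = j + 2"
  show "(fact m / c ^ m :: real) \<ge> 0" using assms by simp
  fix t :: real assume t: "t > 0"
  have "(c / t) ^ m / fact m \<le> exp (c / t)"
    using assms t by (intro power_over_fact_le_exp) auto
  then have "exp (- (c / t)) \<le> fact m / (c / t) ^ m"
    using assms t by (simp add: exp_minus field_simps)
  then have "flat c j t \<le> fact m / (c / t) ^ m / t ^ j"
    using t by (simp add: flat_def divide_right_mono del: divide_divide_eq_left)
  also have "\<dots> = fact m / c ^ m * (t ^ m / t ^ j)"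
    by (simp add: power_divide)
  also have "t ^ m / t ^ j = t\<^sup>2"
    using t by (simp add: m_def power_add power2_eq_square)
  finally show "flat c j t \<le> fact m / c ^ m * t\<^sup>2" .
qed

text \<open>The exponent contributes the factor c / t^2, which raises the index by 2, and the power
  contributes - j / t, which raises it by 1. At t = 0 the quotient vanishes from the left and is
  controlled by the quadratic bound from the right.\<close>

lemma DERIV_flat:
  assumes "c > 0"
  shows "(flat c j has_real_derivative c * flat c (j + 2) t - j * flat c (j + 1) t) (at t)"
proof -
  consider "t > 0" | "t < 0" | "t = 0" by linarith
  then show ?thesis
  proof cases
    case 1
    have "((\<lambda>t. exp (- c / t) / t ^ j) has_real_derivative
        (c / t\<^sup>2 * exp (- c / t) * t ^ j - exp (- c / t) * (j * t ^ (j - 1))) / (t ^ j * t ^ j)) (at t)"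
      using 1 by (auto intro!: derivative_eq_intros simp: power2_eq_square)
    also have "(c / t\<^sup>2 * exp (- c / t) * t ^ j - exp (- c / t) * (j * t ^ (j - 1))) / (t ^ j * t ^ j)
        = c * flat c (j + 2) t - j * flat c (j + 1) t"
      using 1 by (cases j) (auto simp: flat_def field_simps power2_eq_square)
    finally show ?thesis
      by (rule has_field_derivative_transform_within_open[where S="{0<..}"])
         (use 1 in \<open>auto simp: flat_def\<close>)
  next
    case 2
    have "((\<lambda>t. 0) has_real_derivative c * flat c (j + 2) t - j * flat c (j + 1) t) (at t)"
      using 2 by (simp add: flat_def)
    then show ?thesis
      by (rule has_field_derivative_transform_within_open[where S="{..<0}"])
         (use 2 in \<open>auto simp: flat_def\<close>)
  next
    case 3
    obtain B where B: "B \<ge> 0" "\<And>t. t > 0 \<Longrightarrow> flat c j t \<le> B * t\<^sup>2"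
      using flat_le[OF assms] by blast
    have *: "norm ((flat c j (0 + h) - flat c j 0) / h) \<le> B * \<bar>h\<bar>" if "h \<noteq> 0" for h
    proof (cases "h > 0")
      case True
      then show ?thesis using B(2)[OF True] flat_nonneg[of c j h]
        by (simp add: flat_def[of _ _ 0] field_simps power2_eq_square)
    next
      case False
      then show ?thesis using B(1) by (simp add: flat_def mult_nonneg_nonpos)
    qed
    have "((\<lambda>h. (flat c j (0 + h) - flat c j 0) / h) \<longlongrightarrow> 0) (at 0)"
    proof (rule Lim_null_comparison)
      show "\<forall>\<^sub>F h in at 0. norm ((flat c j (0 + h) - flat c j 0) / h) \<le> B * \<bar>h\<bar>"
        using * by (auto simp: eventually_at_filter)
      show "((\<lambda>h. B * \<bar>h\<bar>) \<longlongrightarrow> 0) (at 0)" by (auto intro!: tendsto_eq_intros)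
    qed
    then show ?thesis unfolding 3 DERIV_def by (simp add: flat_def[of _ _ 0])
  qed
qed

lemma continuous_flat: "c > 0 \<Longrightarrow> continuous_on S (flat c j)"
  by (rule DERIV_continuous_on[OF has_field_derivative_at_within[OF DERIV_flat]])

lemma Ck_on_UNIV_flat:
  fixes p :: "'a::euclidean_space \<Rightarrow> real"
  assumes "c > 0" "smooth p"
  shows "Ck_on k UNIV (\<lambda>x. flat c j (p x))"
proof (induction k arbitrary: j)
  case 0
  have "continuous_on UNIV (\<lambda>x. flat c j (p x))"
    by (rule continuous_on_compose2[OF continuous_flat[OF assms(1)] smooth_continuous[OF assms(2)]]) auto
  then show ?case by simp
next
  case (Suc k)
  show ?case
  proof (rule Ck_on_SucI)
    show "((\<lambda>x. flat c j (p x)) has_derivative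
        (\<lambda>i. frechet_derivative p (at x) i * (c * flat c (j + 2) (p x) - j * flat c (j + 1) (p x)))) (at x)" for x
      by (rule DERIV_compose_FDERIV[OF DERIV_flat[OF assms(1)] smooth_has_derivative[OF assms(2)]])
    show "Ck_on k UNIV (\<lambda>x. frechet_derivative p (at x) i *
        (c * flat c (j + 2) (p x) - j * flat c (j + 1) (p x)))" if "i \<in> Basis" for i
      using smooth_partial[OF assms(2) that]
        Ck_on_UNIV_add[OF Ck_on_UNIV_mult[OF Ck_on_UNIV_const[of k c] Suc[of "j + 2"]]
          Ck_on_UNIV_mult[OF Ck_on_UNIV_const[of k "- real j"] Suc[of "j + 1"]]]
      by (intro Ck_on_UNIV_mult) (simp_all add: smooth_def partial_def[abs_def])
  qed
qed

lemma smooth_flat: "c > 0 \<Longrightarrow> smooth p \<Longrightarrow> smooth (\<lambda>x. flat c j (p x))"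
  unfolding smooth_def[of "\<lambda>x. flat c j (p x)"] using Ck_on_UNIV_flat by blast

text \<open>A smooth version of the positive part, equal to t * exp (- c / t) for t > 0. For c > 0
  it lies below the positive part, by at most c.\<close>

definition soft :: "real \<Rightarrow> real \<Rightarrow> real" where
  "soft c t = t * flat c 0 t"

text \<open>The derivative of \<open>soft c\<close> in closed form: exp (- c / t) * (1 + c / t) for
  t > 0.\<close>

definition soft' :: "real \<Rightarrow> real \<Rightarrow> real" where
  "soft' c t = flat c 0 t + c * flat c 1 t"

lemma smooth_soft: "c > 0 \<Longrightarrow> smooth p \<Longrightarrow> smooth (\<lambda>x. soft c (p x))"
  unfolding soft_def by (intro smooth_mult smooth_flat)

lemma DERIV_soft:
  assumes "c > 0"
  shows "(soft c has_real_derivative soft' c t) (at t)"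
proof -
  have "((\<lambda>t. t * flat c 0 t) has_real_derivative soft' c t) (at t)"
    using DERIV_mult[OF DERIV_ident DERIV_flat[OF assms, of 0 t]]
    by (rule DERIV_cong) (auto simp: soft'_def flat_def field_simps power2_eq_square)
  then show ?thesis by (simp add: soft_def[abs_def])
qed

lemma soft_nonpos: "t \<le> 0 \<Longrightarrow> soft c t = 0"
  and soft'_nonpos: "t \<le> 0 \<Longrightarrow> soft' c t = 0"
  and soft_pos: "t > 0 \<Longrightarrow> soft c t > 0"
  by (auto simp: soft_def soft'_def flat_def)

lemma soft_nonneg: "soft c t \<ge> 0"
  using soft_nonpos[of t c] soft_pos[of t c] by (cases "t > 0") auto

text \<open>With s = c / t the upper bound is 1 + s <= exp s. It makes \<open>soft c\<close>
  1-Lipschitz and lets \<open>soft'\<close> act as a bounded multiplier in L2.\<close>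

lemma soft'_bounds:
  assumes "c > 0"
  shows "0 \<le> soft' c t" "soft' c t \<le> 1"
proof -
  show "0 \<le> soft' c t" using assms by (simp add: soft'_def flat_nonneg)
  show "soft' c t \<le> 1"
  proof (cases "t > 0")
    case True
    have "1 + c / t \<le> exp (c / t)" by (rule exp_ge_add_one_self)
    then have "exp (- (c / t)) * (1 + c / t) \<le> 1" by (simp add: exp_minus field_simps)
    then show ?thesis using True by (simp add: soft'_def flat_def field_simps)
  qed (simp add: soft'_nonpos)
qed

text \<open>From exp (- s) >= 1 - s with s = c / t. This bound later confines the support of the
  composite test functions to the smaller domain.\<close>

lemma soft_ge: "c > 0 \<Longrightarrow> t - c \<le> soft c t"
proof (cases "t > 0")
  case True
  have "1 + - c / t \<le> exp (- c / t)" by (rule exp_ge_add_one_self)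
  then have "t * (1 + - c / t) \<le> t * exp (- c / t)" using True by (intro mult_left_mono) auto
  also have "t * (1 + - c / t) = t - c" using True by (simp add: algebra_simps)
  finally show ?thesis using True by (simp add: soft_def flat_def)
qed (simp add: soft_nonpos)

lemma soft_lipschitz:
  assumes "c > 0"
  shows "\<bar>soft c s - soft c t\<bar> \<le> \<bar>s - t\<bar>"
proof -
  have "norm (soft c s - soft c t) \<le> 1 * norm (s - t)"
    by (rule field_differentiable_bound[where S=UNIV and f'="soft' c"])
       (use DERIV_soft[OF assms] soft'_bounds[OF assms] in auto)
  then show ?thesis by simp
qed

lemma continuous_soft: "c > 0 \<Longrightarrow> continuous_on S (soft c)"
  and continuous_soft': "c > 0 \<Longrightarrow> continuous_on S (soft' c)"
  unfolding soft_def[abs_def] soft'_def[abs_def] by (intro continuous_intros continuous_flat; assumption)+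

subsection \<open>Convergence in \<open>L\<^sup>2\<close>\<close>

definition square_integrable :: "'a measure \<Rightarrow> ('a \<Rightarrow> 'b::euclidean_space) \<Rightarrow> bool" where
  "square_integrable M f \<longleftrightarrow> f \<in> borel_measurable M \<and> integrable M (\<lambda>x. (norm (f x))\<^sup>2)"

text \<open>The non-negative integral requires no integrability beforehand, and only the errors have
  to be small: the limit may differ from a square integrable function by a constant, as happens with
  the shift d.\<close>

definition L2_conv :: "'a measure \<Rightarrow> (nat \<Rightarrow> 'a \<Rightarrow> 'b::euclidean_space) \<Rightarrow> ('a \<Rightarrow> 'b) \<Rightarrow> bool" where
  "L2_conv M u f \<longleftrightarrow> (\<forall>n. u n \<in> borel_measurable M) \<and> f \<in> borel_measurable M \<and>
     (\<lambda>n. \<integral>\<^sup>+x. ennreal ((norm (u n x - f x))\<^sup>2) \<partial>M) \<longlonglongrightarrow> 0"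

lemma L2_convD [measurable_dest]:
  "L2_conv M u f \<Longrightarrow> u n \<in> borel_measurable M"
  "L2_conv M u f \<Longrightarrow> f \<in> borel_measurable M"
  by (auto simp: L2_conv_def)

lemma square_integrable_measurable [measurable_dest]:
  "square_integrable M f \<Longrightarrow> f \<in> borel_measurable M"
  by (simp add: square_integrable_def)

lemma norm_add_sq_le: "(norm (a + b :: 'b::real_normed_vector))\<^sup>2 \<le> 2 * (norm a)\<^sup>2 + 2 * (norm b)\<^sup>2"
proof -
  have "(norm (a + b))\<^sup>2 \<le> (norm a + norm b)\<^sup>2"
    by (intro power_mono norm_triangle_ineq) auto
  also have "\<dots> \<le> 2 * (norm a)\<^sup>2 + 2 * (norm b)\<^sup>2"
    using zero_le_power2[of "norm a - norm b"] by (simp add: power2_eq_square algebra_simps)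
  finally show ?thesis .
qed

lemma LIMSEQ_zero_le_ennreal:
  fixes a b :: "nat \<Rightarrow> ennreal"
  assumes "b \<longlonglongrightarrow> 0" "\<And>n. a n \<le> b n"
  shows "a \<longlonglongrightarrow> 0"
proof (rule tendsto_sandwich[OF _ _ tendsto_const assms(1)])
  show "\<forall>\<^sub>F n in sequentially. a n \<le> b n" using assms(2) by simp
qed simp

lemma L2_conv_subseq: "L2_conv M u f \<Longrightarrow> strict_mono r \<Longrightarrow> L2_conv M (\<lambda>n. u (r n)) f"
  unfolding L2_conv_def using LIMSEQ_subseq_LIMSEQ by (fastforce simp: o_def)

text \<open>Domination of the errors. Changes on null sets, sign changes and composition with
  1-Lipschitz functions are all instances.\<close>

lemma L2_conv_null:
  assumes "L2_conv M w h"
    and [measurable]: "\<And>n. u n \<in> borel_measurable M" "f \<in> borel_measurable M"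
    and le: "\<And>n. AE x in M. norm (u n x - f x) \<le> norm (w n x - h x)"
  shows "L2_conv M u f"
proof -
  have "(\<integral>\<^sup>+x. ennreal ((norm (u n x - f x))\<^sup>2) \<partial>M) \<le> (\<integral>\<^sup>+x. ennreal ((norm (w n x - h x))\<^sup>2) \<partial>M)" for n
    by (intro nn_integral_mono_AE, use le[of n] in eventually_elim) (simp add: power_mono)
  moreover have "(\<lambda>n. \<integral>\<^sup>+x. ennreal ((norm (w n x - h x))\<^sup>2) \<partial>M) \<longlonglongrightarrow> 0"
    using assms(1) by (simp add: L2_conv_def)
  ultimately show ?thesis
    unfolding L2_conv_def using assms(2,3) by (blast intro: LIMSEQ_zero_le_ennreal)
qed

lemma L2_conv_cong_AE:
  assumes "L2_conv M u f" "AE x in M. f x = g x" "g \<in> borel_measurable M"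
  shows "L2_conv M u g"
  by (rule L2_conv_null[OF assms(1)]) (use assms in \<open>auto intro: L2_convD\<close>)

lemma L2_conv_add:
  assumes "L2_conv M u f" "L2_conv M v g"
  shows "L2_conv M (\<lambda>n x. u n x + v n x) (\<lambda>x. f x + g x)"
proof -
  note [measurable] = L2_convD[OF assms(1)] L2_convD[OF assms(2)]
  have le: "(\<integral>\<^sup>+x. ennreal ((norm (u n x + v n x - (f x + g x)))\<^sup>2) \<partial>M)
      \<le> 2 * (\<integral>\<^sup>+x. ennreal ((norm (u n x - f x))\<^sup>2) \<partial>M) + 2 * (\<integral>\<^sup>+x. ennreal ((norm (v n x - g x))\<^sup>2) \<partial>M)" for n
  proof -
    have "(\<integral>\<^sup>+x. ennreal ((norm (u n x + v n x - (f x + g x)))\<^sup>2) \<partial>M)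
      \<le> (\<integral>\<^sup>+x. 2 * ennreal ((norm (u n x - f x))\<^sup>2) + 2 * ennreal ((norm (v n x - g x))\<^sup>2) \<partial>M)"
    proof (intro nn_integral_mono)
      fix x
      have "ennreal ((norm (u n x + v n x - (f x + g x)))\<^sup>2)
        \<le> ennreal (2 * (norm (u n x - f x))\<^sup>2 + 2 * (norm (v n x - g x))\<^sup>2)"
        using norm_add_sq_le[of "u n x - f x" "v n x - g x"] by (intro ennreal_leI) (simp add: algebra_simps)
      then show "ennreal ((norm (u n x + v n x - (f x + g x)))\<^sup>2)
        \<le> 2 * ennreal ((norm (u n x - f x))\<^sup>2) + 2 * ennreal ((norm (v n x - g x))\<^sup>2)"
        by (simp add: ennreal_plus ennreal_mult)
    qed
    then show ?thesis by (simp add: nn_integral_add nn_integral_cmult)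
  qed
  have "(\<lambda>n. 2 * (\<integral>\<^sup>+x. ennreal ((norm (u n x - f x))\<^sup>2) \<partial>M) + 2 * (\<integral>\<^sup>+x. ennreal ((norm (v n x - g x))\<^sup>2) \<partial>M))
      \<longlonglongrightarrow> 2 * 0 + 2 * 0"
    using assms by (intro tendsto_add ennreal_tendsto_cmult) (auto simp: L2_conv_def)
  then have "(\<lambda>n. \<integral>\<^sup>+x. ennreal ((norm (u n x + v n x - (f x + g x)))\<^sup>2) \<partial>M) \<longlonglongrightarrow> 0"
    using LIMSEQ_zero_le_ennreal[OF _ le] by simp
  then show ?thesis unfolding L2_conv_def by auto
qed

lemma L2_conv_uminus: "L2_conv M u f \<Longrightarrow> L2_conv M (\<lambda>n x. - u n x) (\<lambda>x. - f x)"
  by (rule L2_conv_null) (auto simp: norm_minus_commute dest: L2_convD)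

lemma L2_conv_diff:
  "L2_conv M u f \<Longrightarrow> L2_conv M v g \<Longrightarrow> L2_conv M (\<lambda>n x. u n x - v n x) (\<lambda>x. f x - g x)"
  using L2_conv_add[OF _ L2_conv_uminus, of M u f v g] by simp

lemma L2_conv_const: "f \<in> borel_measurable M \<Longrightarrow> L2_conv M (\<lambda>n. f) f"
  by (simp add: L2_conv_def)

lemma square_integrable_iff:
  "square_integrable M f \<longleftrightarrow> f \<in> borel_measurable M \<and> (\<integral>\<^sup>+x. ennreal ((norm (f x))\<^sup>2) \<partial>M) < \<infinity>"
  by (auto simp: square_integrable_def integrable_iff_bounded)

lemma square_integrable_add:
  assumes "square_integrable M f" "square_integrable M g"
  shows "square_integrable M (\<lambda>x. f x + g x)"
proof -
  note [measurable] = assms[THEN square_integrable_measurable]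
  have "integrable M (\<lambda>x. (norm (f x + g x))\<^sup>2)"
    by (rule Bochner_Integration.integrable_bound[of _ "\<lambda>x. 2 * (norm (f x))\<^sup>2 + 2 * (norm (g x))\<^sup>2"])
       (use assms norm_add_sq_le in \<open>auto simp: square_integrable_def\<close>)
  then show ?thesis by (simp add: square_integrable_def)
qed

lemma square_integrable_uminus: "square_integrable M f \<Longrightarrow> square_integrable M (\<lambda>x. - f x)"
  by (simp add: square_integrable_def)

lemma square_integrable_diff:
  "square_integrable M f \<Longrightarrow> square_integrable M g \<Longrightarrow> square_integrable M (\<lambda>x. f x - g x)"
  using square_integrable_add[OF _ square_integrable_uminus, of M f g] by simp

text \<open>For one large n the error has finite L2 norm, and f is u n minus this error.\<close>

lemma L2_conv_square_integrable:
  assumes conv: "L2_conv M u f" and u: "\<And>n. square_integrable M (u n)"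
  shows "square_integrable M f"
proof -
  note [measurable] = L2_convD[OF conv]
  have "\<forall>\<^sub>F n in sequentially. (\<integral>\<^sup>+x. ennreal ((norm (u n x - f x))\<^sup>2) \<partial>M) < \<infinity>"
    using conv by (intro order_tendstoD(2)[of _ 0]) (auto simp: L2_conv_def)
  then obtain n where "(\<integral>\<^sup>+x. ennreal ((norm (u n x - f x))\<^sup>2) \<partial>M) < \<infinity>"
    by (auto simp: eventually_sequentially)
  then have "square_integrable M (\<lambda>x. u n x - f x)"
    by (simp add: square_integrable_iff)
  from square_integrable_diff[OF u[of n] this] show ?thesis by simp
qed

lemma integrable_inner_square_integrable:
  assumes "square_integrable M f" "square_integrable M g"
  shows "integrable M (\<lambda>x. f x \<bullet> g x)"
proof (rule Bochner_Integration.integrable_bound[of _ "\<lambda>x. (norm (f x))\<^sup>2 + (norm (g x))\<^sup>2"])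
  show "AE x in M. norm (f x \<bullet> g x) \<le> norm ((norm (f x))\<^sup>2 + (norm (g x))\<^sup>2)"
  proof (rule AE_I2)
    fix x
    have "\<bar>f x \<bullet> g x\<bar> \<le> norm (f x) * norm (g x)" by (rule Cauchy_Schwarz_ineq2)
    also have "\<dots> \<le> (norm (f x))\<^sup>2 + (norm (g x))\<^sup>2"
      using zero_le_power2[of "norm (f x) - norm (g x)"]
        mult_nonneg_nonneg[OF norm_ge_zero[of "f x"] norm_ge_zero[of "g x"]]
      unfolding power2_eq_square by (simp add: algebra_simps del: norm_ge_zero zero_le_mult_iff)
    finally show "norm (f x \<bullet> g x) \<le> norm ((norm (f x))\<^sup>2 + (norm (g x))\<^sup>2)" by simp
  qed
qed (use assms in \<open>auto simp: square_integrable_def\<close>)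

text \<open>Cauchy-Schwarz bounds the squared difference of the integrals by \<open>A n * B\<close>.
  Finiteness of \<open>B\<close> is needed for this product to tend to 0 in the extended
  non-negative reals.\<close>

lemma L2_conv_integral_inner:
  assumes conv: "L2_conv M u f" and u: "\<And>n. square_integrable M (u n)"
    and h: "square_integrable M h"
  shows "(\<lambda>n. \<integral>x. u n x \<bullet> h x \<partial>M) \<longlonglongrightarrow> (\<integral>x. f x \<bullet> h x \<partial>M)"
proof -
  note f = L2_conv_square_integrable[OF conv u]
  note [measurable] = L2_convD[OF conv] square_integrable_measurable[OF h]
  define A where "A n = (\<integral>\<^sup>+x. ennreal ((norm (u n x - f x))\<^sup>2) \<partial>M)" for n
  define B where "B = (\<integral>\<^sup>+x. ennreal ((norm (h x))\<^sup>2) \<partial>M)"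
  have B: "B < \<infinity>" using h by (simp add: square_integrable_iff B_def)
  have le: "ennreal ((norm ((\<integral>x. u n x \<bullet> h x \<partial>M) - (\<integral>x. f x \<bullet> h x \<partial>M)))\<^sup>2) \<le> A n * B" for n
  proof -
    have int: "integrable M (\<lambda>x. (u n x - f x) \<bullet> h x)"
      by (intro integrable_inner_square_integrable square_integrable_diff u f h)
    have "(\<integral>x. u n x \<bullet> h x \<partial>M) - (\<integral>x. f x \<bullet> h x \<partial>M) = (\<integral>x. (u n x - f x) \<bullet> h x \<partial>M)"
      by (simp add: inner_diff_left integrable_inner_square_integrable u f h)
    also have "ennreal (norm \<dots>) \<le> (\<integral>\<^sup>+x. norm ((u n x - f x) \<bullet> h x) \<partial>M)"
      by (rule integral_norm_bound_ennreal[OF int])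
    also have "\<dots> \<le> (\<integral>\<^sup>+x. ennreal (norm (u n x - f x)) * ennreal (norm (h x)) \<partial>M)"
      by (intro nn_integral_mono) (simp add: Cauchy_Schwarz_ineq2 flip: ennreal_mult)
    finally have "(ennreal (norm ((\<integral>x. u n x \<bullet> h x \<partial>M) - (\<integral>x. f x \<bullet> h x \<partial>M))))\<^sup>2
        \<le> (\<integral>\<^sup>+x. ennreal (norm (u n x - f x)) * ennreal (norm (h x)) \<partial>M)\<^sup>2"
      by (intro power_mono) auto
    also have "\<dots> \<le> A n * B"
      unfolding A_def B_def ennreal_power[OF norm_ge_zero, symmetric]
      by (rule Cauchy_Schwarz_nn_integral) measurable
    finally show ?thesis by (simp add: ennreal_power)
  qed
  have "(\<lambda>n. B * A n) \<longlonglongrightarrow> B * 0"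
    using conv B by (intro ennreal_tendsto_cmult) (simp_all add: A_def[abs_def] L2_conv_def)
  then have "(\<lambda>n. ennreal ((norm ((\<integral>x. u n x \<bullet> h x \<partial>M) - (\<integral>x. f x \<bullet> h x \<partial>M)))\<^sup>2)) \<longlonglongrightarrow> 0"
    using LIMSEQ_zero_le_ennreal[OF _ le] by (simp add: mult.commute[of B])
  then have "(\<lambda>n. (norm ((\<integral>x. u n x \<bullet> h x \<partial>M) - (\<integral>x. f x \<bullet> h x \<partial>M)))\<^sup>2) \<longlonglongrightarrow> 0"
    by (subst (asm) ennreal_tendsto_0_iff) auto
  then show ?thesis
    by (simp add: LIM_zero_iff tendsto_rabs_zero_iff)
qed

text \<open>The squared errors tend to 0 in L1, and such a sequence has a subsequence that tends to
  0 almost everywhere.\<close>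

lemma L2_conv_AE_subseq:
  assumes conv: "L2_conv M u f"
  obtains r where "strict_mono r" "AE x in M. (\<lambda>n. u (r n) x) \<longlonglongrightarrow> f x"
proof -
  note [measurable] = L2_convD[OF conv]
  define A where "A n = (\<integral>\<^sup>+x. ennreal ((norm (u n x - f x))\<^sup>2) \<partial>M)" for n
  have A: "A \<longlonglongrightarrow> 0" using conv by (simp add: L2_conv_def A_def[abs_def])
  then have "\<forall>\<^sub>F n in sequentially. A n < \<infinity>" by (intro order_tendstoD(2)[of _ 0]) auto
  then obtain N where N: "\<And>n. n \<ge> N \<Longrightarrow> A n < \<infinity>" by (auto simp: eventually_sequentially)
  \<comment> \<open>The shift by \<open>N\<close> skips the finitely many indices whose error may be
    infinite, because every term of the L1 sequence must be integrable.\<close>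
  define w where "w n x = (norm (u (n + N) x - f x))\<^sup>2" for n x
  have int: "integrable M (w n)" for n
    using N[of "n + N"] by (auto simp: w_def[abs_def] integrable_iff_bounded A_def)
  have "(\<lambda>n. \<integral>x. norm (w n x) \<partial>M) \<longlonglongrightarrow> 0"
  proof -
    have "ennreal (\<integral>x. norm (w n x) \<partial>M) = A (n + N)" for n
      using nn_integral_eq_integral[OF integrable_norm[OF int[of n]]]
      by (simp add: A_def w_def)
    then have "(\<lambda>n. ennreal (\<integral>x. norm (w n x) \<partial>M)) \<longlonglongrightarrow> 0"
      using LIMSEQ_ignore_initial_segment[OF A, of N] by simp
    then show ?thesis by (subst (asm) ennreal_tendsto_0_iff) auto
  qed
  from tendsto_L1_AE_subseq[OF int this] obtain r where r: "strict_mono r"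
    and ae: "AE x in M. (\<lambda>n. w (r n) x) \<longlonglongrightarrow> 0" by blast
  show ?thesis
  proof
    show "strict_mono (\<lambda>n. r n + N)" using r by (simp add: strict_mono_def)
    show "AE x in M. (\<lambda>n. u (r n + N) x) \<longlonglongrightarrow> f x"
      using ae
    proof eventually_elim
      case (elim x)
      then have "(\<lambda>n. norm (u (r n + N) x - f x)) \<longlonglongrightarrow> 0" by (simp add: w_def)
      then show ?case using LIM_zero_iff tendsto_norm_zero_iff by blast
    qed
  qed
qed

text \<open>The error splits into H (u n) (w n - g), which is at most |w n - g| in norm, and (H (u
  n) - H f) g, which tends to 0 by dominated convergence with majorant 4 |g|^2, as H varies by at
  most 2. It serves the chain rule, with H = \<open>soft' c\<close>.\<close>

lemma L2_conv_scaleR_bounded: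
  fixes H :: "real \<Rightarrow> real"
  assumes w: "L2_conv M w g" and g: "square_integrable M g"
    and [measurable]: "\<And>n. u n \<in> borel_measurable M" "f \<in> borel_measurable M"
    and ae: "AE x in M. (\<lambda>n. u n x) \<longlonglongrightarrow> f x"
    and H: "continuous_on UNIV H" "\<And>t. \<bar>H t\<bar> \<le> 1"
  shows "L2_conv M (\<lambda>n x. H (u n x) *\<^sub>R w n x) (\<lambda>x. H (f x) *\<^sub>R g x)"
proof -
  note [measurable] = L2_convD[OF w] borel_measurable_continuous_onI[OF H(1)]
  have 1: "L2_conv M (\<lambda>n x. H (u n x) *\<^sub>R (w n x - g x)) (\<lambda>x. 0)"
  proof (rule L2_conv_null[OF w])
    show "AE x in M. norm (H (u n x) *\<^sub>R (w n x - g x) - 0) \<le> norm (w n x - g x)" for n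
      using mult_right_mono[OF H(2) norm_ge_zero] by (auto simp: AE_I2)
  qed auto
  have 2: "L2_conv M (\<lambda>n x. (H (u n x) - H (f x)) *\<^sub>R g x) (\<lambda>x. 0)"
  proof -
    have "(\<lambda>n. \<integral>\<^sup>+x. ennreal ((norm ((H (u n x) - H (f x)) *\<^sub>R g x))\<^sup>2) \<partial>M) \<longlonglongrightarrow> (\<integral>\<^sup>+x. 0 \<partial>M)"
    proof (rule nn_integral_dominated_convergence[where w="\<lambda>x. ennreal (4 * (norm (g x))\<^sup>2)"])
      show "AE x in M. ennreal ((norm ((H (u n x) - H (f x)) *\<^sub>R g x))\<^sup>2) \<le> ennreal (4 * (norm (g x))\<^sup>2)" for n
      proof (intro AE_I2 ennreal_leI)
        fix x
        have "norm (H (u n x) - H (f x)) \<le> 2" using H(2)[of "u n x"] H(2)[of "f x"] by simp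
        then have "(\<bar>H (u n x) - H (f x)\<bar> * norm (g x))\<^sup>2 \<le> (2 * norm (g x))\<^sup>2"
          by (intro power_mono mult_right_mono) auto
        then show "(norm ((H (u n x) - H (f x)) *\<^sub>R g x))\<^sup>2 \<le> 4 * (norm (g x))\<^sup>2"
          by (simp add: power_mult_distrib)
      qed
      show "(\<integral>\<^sup>+x. ennreal (4 * (norm (g x))\<^sup>2) \<partial>M) < \<infinity>"
        using g by (simp add: square_integrable_iff ennreal_mult nn_integral_cmult ennreal_mult_less_top)
      show "AE x in M. (\<lambda>n. ennreal ((norm ((H (u n x) - H (f x)) *\<^sub>R g x))\<^sup>2)) \<longlonglongrightarrow> 0"
        using ae
      proof eventually_elim
        case (elim x)
        have "(\<lambda>n. H (u n x)) \<longlonglongrightarrow> H (f x)"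
          using H(1) elim by (auto simp: continuous_on_eq_continuous_at intro: isCont_tendsto_compose)
        then have "(\<lambda>n. (norm ((H (u n x) - H (f x)) *\<^sub>R g x))\<^sup>2) \<longlonglongrightarrow> (norm ((H (f x) - H (f x)) *\<^sub>R g x))\<^sup>2"
          by (intro tendsto_intros)
        then show ?case by (subst ennreal_tendsto_0_iff) auto
      qed
    qed measurable
    then show ?thesis by (auto simp: L2_conv_def)
  qed
  have 3: "L2_conv M (\<lambda>n x. H (f x) *\<^sub>R g x) (\<lambda>x. H (f x) *\<^sub>R g x)"
    by (rule L2_conv_const) measurable
  show ?thesis
    using L2_conv_add[OF L2_conv_add[OF 1 2] 3] by (simp add: algebra_simps)
qed

lemma L2_conv_AE_zero:
  assumes conv: "L2_conv M u f" and u: "\<And>n x. x \<in> A \<Longrightarrow> u n x = 0"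
  shows "AE x in M. x \<in> A \<longrightarrow> f x = 0"
proof -
  obtain r where "strict_mono r" and ae: "AE x in M. (\<lambda>n. u (r n) x) \<longlonglongrightarrow> f x"
    using L2_conv_AE_subseq[OF conv] by blast
  from ae show ?thesis
  proof eventually_elim
    case (elim x)
    then show ?case using u LIMSEQ_unique[OF elim, of 0] by auto
  qed
qed

subsection \<open>Gradients and integration by parts\<close>

definition grad :: "('a::euclidean_space \<Rightarrow> real) \<Rightarrow> 'a \<Rightarrow> 'a" where
  "grad f x = (\<Sum>i\<in>Basis. partial f i x *\<^sub>R i)"

lemma grad_inner: "i \<in> Basis \<Longrightarrow> grad f x \<bullet> i = partial f i x"
  by (simp add: grad_def inner_sum_left inner_Basis if_distrib cong: if_cong)

lemma gradI: "(f has_derivative (\<lambda>h. g \<bullet> h)) (at x) \<Longrightarrow> grad f x = g"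
  by (simp add: grad_def partial_eq euclidean_representation)

lemma has_derivative_grad:
  assumes "smooth f"
  shows "(f has_derivative (\<lambda>h. grad f x \<bullet> h)) (at x)"
proof -
  have d: "(f has_derivative frechet_derivative f (at x)) (at x)"
    by (rule smooth_has_derivative[OF assms])
  interpret linear "frechet_derivative f (at x)" by (rule has_derivative_linear[OF d])
  have "frechet_derivative f (at x) h = grad f x \<bullet> h" for h
  proof -
    have "frechet_derivative f (at x) h = frechet_derivative f (at x) (\<Sum>i\<in>Basis. (h \<bullet> i) *\<^sub>R i)"
      by (simp add: euclidean_representation)
    also have "\<dots> = (\<Sum>i\<in>Basis. (h \<bullet> i) * partial f i x)"
      by (simp add: sum scale partial_def)
    also have "\<dots> = grad f x \<bullet> h"
      by (simp add: grad_def inner_sum_left inner_commute[of h] mult.commute)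
    finally show ?thesis .
  qed
  then have "frechet_derivative f (at x) = (\<bullet>) (grad f x)" by blast
  then show ?thesis using d by simp
qed

lemma grad_diff: "smooth f \<Longrightarrow> smooth g \<Longrightarrow> grad (\<lambda>x. f x - g x) x = grad f x - grad g x"
  and grad_uminus: "smooth f \<Longrightarrow> grad (\<lambda>x. - f x) x = - grad f x"
  and grad_mult: "smooth f \<Longrightarrow> smooth g \<Longrightarrow> grad (\<lambda>x. f x * g x) x = f x *\<^sub>R grad g x + g x *\<^sub>R grad f x"
  by (rule gradI, auto intro!: derivative_eq_intros has_derivative_grad
      simp: inner_add_left inner_diff_left)+

lemma grad_soft:
  assumes "c > 0" "smooth f"
  shows "grad (\<lambda>x. soft c (f x)) x = soft' c (f x) *\<^sub>R grad f x"
proof (rule gradI)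
  have "((\<lambda>x. soft c (f x)) has_derivative (\<lambda>h. grad f x \<bullet> h * soft' c (f x))) (at x)"
    by (rule DERIV_compose_FDERIV[OF DERIV_soft[OF assms(1)] has_derivative_grad[OF assms(2)]])
  then show "((\<lambda>x. soft c (f x)) has_derivative (\<bullet>) (soft' c (f x) *\<^sub>R grad f x)) (at x)"
    by (rule has_derivative_eq_rhs) (simp add: fun_eq_iff)
qed

lemma grad_scaleR:
  assumes "smooth f"
  shows "grad (\<lambda>x. f (s *\<^sub>R x)) x = s *\<^sub>R grad f (s *\<^sub>R x)"
proof (rule gradI)
  have "((\<lambda>x. f (s *\<^sub>R x)) has_derivative (\<lambda>h. grad f (s *\<^sub>R x) \<bullet> (s *\<^sub>R h))) (at x)"
    by (rule has_derivative_compose[OF _ has_derivative_grad[OF assms]])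
       (auto intro!: derivative_eq_intros)
  then show "((\<lambda>x. f (s *\<^sub>R x)) has_derivative (\<bullet>) (s *\<^sub>R grad f (s *\<^sub>R x))) (at x)"
    by (rule has_derivative_eq_rhs) (simp add: fun_eq_iff)
qed

lemma continuous_partial: "smooth f \<Longrightarrow> i \<in> Basis \<Longrightarrow> continuous_on S (partial f i)"
  by (intro smooth_continuous smooth_partial)

lemma continuous_grad: "smooth f \<Longrightarrow> continuous_on S (grad f)"
  unfolding grad_def[abs_def] by (intro continuous_intros continuous_partial)

section \<open>Compact support and integration by parts\<close>

lemma continuous_borel_lebesgue: "continuous_on UNIV f \<Longrightarrow> f \<in> borel_measurable lebesgue"
  by (intro measurable_completion) (simp add: borel_measurable_continuous_onI)

lemma continuous_compact_support_integrable:
  fixes f :: "'a::euclidean_space \<Rightarrow> 'b::euclidean_space"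
  assumes "continuous_on UNIV f" "compact K" "\<And>x. x \<notin> K \<Longrightarrow> f x = 0"
  shows "integrable lebesgue f"
proof -
  have "integrable lborel (\<lambda>x. indicator K x *\<^sub>R f x)"
    using assms by (intro borel_integrable_compact continuous_on_subset[OF assms(1)]) auto
  also have "(\<lambda>x. indicator K x *\<^sub>R f x) = f"
    using assms(3) by (auto simp: indicator_def)
  finally show ?thesis
    by (subst integrable_completion) (use assms(1) in \<open>simp_all add: borel_measurable_continuous_onI\<close>)
qed

lemma continuous_compact_support_square_integrable:
  fixes f :: "'a::euclidean_space \<Rightarrow> 'b::euclidean_space"
  assumes "continuous_on UNIV f" "compact K" "\<And>x. x \<notin> K \<Longrightarrow> f x = 0"
  shows "square_integrable lebesgue f"
  unfolding square_integrable_def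
proof
  show "f \<in> borel_measurable lebesgue" by (rule continuous_borel_lebesgue[OF assms(1)])
  show "integrable lebesgue (\<lambda>x. (norm (f x))\<^sup>2)"
    by (rule continuous_compact_support_integrable[OF _ assms(2)])
       (use assms in \<open>auto intro!: continuous_intros\<close>)
qed

text \<open>Any compact subset of U that carries \<psi> may stand in for the topological support, so
  that supports of products, composites and dilations never have to be computed.\<close>

lemma test_functions_iff:
  "\<psi> \<in> test_functions U \<longleftrightarrow> smooth \<psi> \<and> (\<exists>K. compact K \<and> K \<subseteq> U \<and> (\<forall>x. x \<notin> K \<longrightarrow> \<psi> x = 0))"
proof
  assume R: "smooth \<psi> \<and> (\<exists>K. compact K \<and> K \<subseteq> U \<and> (\<forall>x. x \<notin> K \<longrightarrow> \<psi> x = 0))"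
  then obtain K where K: "compact K" "K \<subseteq> U" "\<And>x. x \<notin> K \<Longrightarrow> \<psi> x = 0" by blast
  then have "closure {x. \<psi> x \<noteq> 0} \<subseteq> K"
    by (intro closure_minimal) (auto intro: compact_imp_closed)
  moreover from this have "compact (closure {x. \<psi> x \<noteq> 0})"
    using compact_Int_closed[OF K(1) closed_closure, of "{x. \<psi> x \<noteq> 0}"]
    by (simp add: Int_absorb1 del: compact_closure)
  ultimately show "\<psi> \<in> test_functions U"
    using R K(2) by (auto simp: test_functions_def smooth_def)
next
  assume "\<psi> \<in> test_functions U"
  then show "smooth \<psi> \<and> (\<exists>K. compact K \<and> K \<subseteq> U \<and> (\<forall>x. x \<notin> K \<longrightarrow> \<psi> x = 0))"
    using closure_subset[of "{x. \<psi> x \<noteq> 0}"]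
    by (auto simp: test_functions_def smooth_def intro!: exI[of _ "closure {x. \<psi> x \<noteq> 0}"])
qed

lemma partial_zero_outside:
  assumes "closed K" "\<And>x. x \<notin> K \<Longrightarrow> f x = 0" "x \<notin> K"
  shows "partial f i x = 0"
proof -
  have "(f has_derivative (\<lambda>h. 0)) (at x)"
    by (rule has_derivative_transform_within_open[where s="- K" and f="\<lambda>x. 0"]) (use assms in auto)
  then show ?thesis by (rule partial_eq)
qed

lemma test_functionE:
  assumes "\<psi> \<in> test_functions U"
  obtains K where "smooth \<psi>" "compact K" "K \<subseteq> U" "\<And>x. x \<notin> K \<Longrightarrow> \<psi> x = 0"
    "\<And>x i. x \<notin> K \<Longrightarrow> partial \<psi> i x = 0" "\<And>x. x \<notin> K \<Longrightarrow> grad \<psi> x = 0"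
proof -
  from assms obtain K where K: "smooth \<psi>" "compact K" "K \<subseteq> U" "\<And>x. x \<notin> K \<Longrightarrow> \<psi> x = 0"
    unfolding test_functions_iff by blast
  have "partial \<psi> i x = 0" if "x \<notin> K" for x i
    using partial_zero_outside[OF compact_imp_closed[OF K(2)] K(4) that] .
  moreover from this have "grad \<psi> x = 0" if "x \<notin> K" for x
    using that by (simp add: grad_def)
  ultimately show ?thesis using that K by blast
qed

lemma test_function_square_integrable:
  assumes "\<psi> \<in> test_functions U"
  shows "square_integrable lebesgue \<psi>" "i \<in> Basis \<Longrightarrow> square_integrable lebesgue (partial \<psi> i)"
    "square_integrable lebesgue (grad \<psi>)"
  using assms
  by (auto elim!: test_functionE intro!: continuous_compact_support_square_integrable
      smooth_continuous smooth_partial continuous_grad)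

lemma integral_lborel_translate:
  fixes f :: "'a::euclidean_space \<Rightarrow> real"
  assumes "f \<in> borel_measurable borel"
  shows "(\<integral>x. f (a + x) \<partial>lborel) = (\<integral>x. f x \<partial>lborel)"
proof -
  have "(\<integral>x. f x \<partial>lborel) = (\<integral>x. f x \<partial>distr lborel borel ((+) a))"
    by (simp add: lborel_distr_plus)
  also have "\<dots> = (\<integral>x. f (a + x) \<partial>lborel)"
    by (rule integral_distr) (use assms in auto)
  finally show ?thesis by simp
qed

text \<open>By translation invariance the integrals of all difference quotients vanish.\<close>

lemma integral_partial_eq_0:
  fixes f :: "'a::euclidean_space \<Rightarrow> real"
  assumes f: "smooth f" and K: "compact K" "\<And>x. x \<notin> K \<Longrightarrow> f x = 0" and i: "i \<in> Basis"
  shows "(\<integral>x. partial f i x \<partial>lebesgue) = 0"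
proof -
  have cf: "continuous_on UNIV f" by (rule smooth_continuous[OF f])
  have cp: "continuous_on UNIV (partial f i)" by (rule continuous_partial[OF f i])
  have [measurable]: "f \<in> borel_measurable borel" "partial f i \<in> borel_measurable borel"
    using cf cp by (auto intro: borel_measurable_continuous_onI)
  have intf: "integrable lborel f"
    using continuous_compact_support_integrable[OF cf K] by (simp add: integrable_completion)
  obtain B where B: "\<And>x. \<bar>partial f i x\<bar> \<le> B"
  proof -
    have "compact (partial f i ` K)"
      by (rule compact_continuous_image[OF continuous_on_subset[OF cp] K(1)]) auto
    then obtain b where b: "\<And>x. x \<in> K \<Longrightarrow> \<bar>partial f i x\<bar> \<le> b"
      using compact_imp_bounded bounded_iff by (metis image_eqI real_norm_def)
    \<comment> \<open>If \<open>K\<close> is empty, b may be negative; outside \<open>K\<close> the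
      derivative is 0.\<close>
    have "\<bar>partial f i x\<bar> \<le> max b 0" for x
      using b[of x] partial_zero_outside[where f=f and x=x and i=i, OF compact_imp_closed[OF K(1)] K(2)]
      by (cases "x \<in> K") auto
    then show ?thesis using that by blast
  qed
  define a where "a n = 1 / real (Suc n)" for n
  have a: "a n > 0" "a n \<le> 1" for n by (auto simp: a_def)
  have a0: "a \<longlonglongrightarrow> 0" unfolding a_def[abs_def] by (rule LIMSEQ_Suc[OF lim_1_over_n])
  define q where "q n x = (f (a n *\<^sub>R i + x) - f x) / a n" for n x
  have D: "((\<lambda>t. f (x + t *\<^sub>R i)) has_real_derivative partial f i (x + t *\<^sub>R i)) (at t)" for x t
  proof -
    have "((\<lambda>t. f (x + t *\<^sub>R i)) has_derivative (\<lambda>h. grad f (x + t *\<^sub>R i) \<bullet> (h *\<^sub>R i))) (at t)"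
      by (rule has_derivative_compose[OF _ has_derivative_grad[OF f]])
         (auto intro!: derivative_eq_intros)
    then show ?thesis
      by (simp add: has_field_derivative_def grad_inner[OF i] mult.commute[of _ "partial f i (x + t *\<^sub>R i)"])
  qed
  have qB: "\<bar>q n x\<bar> \<le> B" for n x
  proof -
    obtain z where "f (x + a n *\<^sub>R i) - f (x + 0 *\<^sub>R i) = (a n - 0) * partial f i (x + z *\<^sub>R i)"
      using MVT2[OF a(1)[of n], of "\<lambda>t. f (x + t *\<^sub>R i)" "\<lambda>t. partial f i (x + t *\<^sub>R i)"] D by blast
    then have "q n x = partial f i (x + z *\<^sub>R i)"
      using a[of n] by (simp add: q_def add.commute)
    then show ?thesis using B by simp
  qed
  \<comment> \<open>The set swept out by \<open>K\<close> when it moves back along i by at most 1.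
    Since a n <= 1, it carries all difference quotients at once, which gives a common integrable
    majorant.\<close>
  define K' where "K' = {x + t *\<^sub>R - i |x t. x \<in> K \<and> t \<in> {0..1}}"
  have K': "compact K'"
  proof -
    have "K' = (\<lambda>(x, t). x + t *\<^sub>R - i) ` (K \<times> {0..1})"
      unfolding K'_def by force
    then show ?thesis
      using K(1) by (auto intro!: compact_continuous_image compact_Times continuous_intros
          simp: case_prod_unfold)
  qed
  have q0: "q n x = 0" if "x \<notin> K'" for n x
  proof -
    have "x \<notin> K" using that unfolding K'_def by force
    moreover have "a n *\<^sub>R i + x \<notin> K"
    proof
      assume "a n *\<^sub>R i + x \<in> K"
      then have "(a n *\<^sub>R i + x) + a n *\<^sub>R - i \<in> K'"
        using a[of n] unfolding K'_def by fastforce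
      with that show False by simp
    qed
    ultimately show ?thesis by (simp add: q_def K(2))
  qed
  have "(\<lambda>n. \<integral>x. q n x \<partial>lborel) \<longlonglongrightarrow> (\<integral>x. partial f i x \<partial>lborel)"
  proof (rule integral_dominated_convergence[where w="\<lambda>x. indicator K' x *\<^sub>R B"])
    show "integrable lborel (\<lambda>x. indicator K' x *\<^sub>R B)"
      by (rule borel_integrable_compact[OF K']) simp
    show "AE x in lborel. (\<lambda>n. q n x) \<longlonglongrightarrow> partial f i x"
    proof (rule AE_I2)
      fix x
      have "((\<lambda>h. (f (x + h *\<^sub>R i) - f x) / h) \<longlongrightarrow> partial f i x) (at 0)"
        using D[of x 0] by (simp add: DERIV_def)
      moreover have "filterlim a (at 0) sequentially"
        using a0 a by (auto simp: filterlim_at intro!: always_eventually dest: less_imp_neq)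
          (metis less_irrefl)
      ultimately have "(\<lambda>n. (f (x + a n *\<^sub>R i) - f x) / a n) \<longlonglongrightarrow> partial f i x"
        by (rule filterlim_compose)
      then show "(\<lambda>n. q n x) \<longlonglongrightarrow> partial f i x" by (simp add: q_def add.commute)
    qed
    show "AE x in lborel. norm (q n x) \<le> indicator K' x *\<^sub>R B" for n
      using qB[of n] q0[of _ n] by (auto simp: indicator_def)
    show "q n \<in> borel_measurable lborel" for n unfolding q_def[abs_def] by measurable
  qed simp
  moreover have "(\<integral>x. q n x \<partial>lborel) = 0" for n
  proof -
    have "integrable lborel (\<lambda>x. f (a n *\<^sub>R i + x))"
    proof -
      have "integrable (distr lborel borel ((+) (a n *\<^sub>R i))) f"
        using intf by (simp add: lborel_distr_plus)
      then show ?thesis by (subst (asm) integrable_distr_eq) auto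
    qed
    then show ?thesis
      by (simp add: q_def intf integral_lborel_translate)
  qed
  ultimately have "(\<integral>x. partial f i x \<partial>lborel) = 0"
    by (simp add: LIMSEQ_const_iff)
  then show ?thesis by (simp add: integral_completion)
qed

text \<open>The product of f and \<psi> has compact support although f need not, so the integral of
  its partial derivative vanishes.\<close>

lemma integration_by_parts:
  assumes \<psi>: "\<psi> \<in> test_functions U" and f: "smooth f" and i: "i \<in> Basis"
  shows "(\<integral>x. f x * partial \<psi> i x \<partial>lebesgue) = - (\<integral>x. partial f i x * \<psi> x \<partial>lebesgue)"
proof -
  obtain K where K: "smooth \<psi>" "compact K" "\<And>x. x \<notin> K \<Longrightarrow> \<psi> x = 0"
    "\<And>x i. x \<notin> K \<Longrightarrow> partial \<psi> i x = 0"
    by (rule test_functionE[OF \<psi>]) blast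
  have p: "partial (\<lambda>x. f x * \<psi> x) i x = f x * partial \<psi> i x + partial f i x * \<psi> x" for x
    using grad_mult[OF f K(1), of x] i by (simp flip: grad_inner add: inner_add_left mult.commute)
  have "(\<integral>x. partial (\<lambda>x. f x * \<psi> x) i x \<partial>lebesgue) = 0"
    by (rule integral_partial_eq_0[OF smooth_mult[OF f K(1)] K(2) _ i]) (simp add: K(3))
  moreover have "integrable lebesgue (\<lambda>x. f x * partial \<psi> i x)" "integrable lebesgue (\<lambda>x. partial f i x * \<psi> x)"
    by (rule continuous_compact_support_integrable[OF _ K(2)];
        simp add: K(3,4) continuous_on_mult smooth_continuous smooth_partial f K(1) i)+
  ultimately show ?thesis by (simp add: p)
qed

subsection \<open>Uniqueness of weak gradients\<close>

definition box_bump :: "'a::euclidean_space \<Rightarrow> 'a \<Rightarrow> nat \<Rightarrow> 'a \<Rightarrow> real" where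
  "box_bump a b n x = (\<Prod>i\<in>Basis. flat (1 / real (Suc n)) 0 (x \<bullet> i - a \<bullet> i) * flat (1 / real (Suc n)) 0 (b \<bullet> i - x \<bullet> i))"

lemma flat_0_le_1: "c \<ge> 0 \<Longrightarrow> flat c 0 t \<le> 1"
  by (simp add: flat_def)

lemma box_bump_bounds: "0 \<le> box_bump a b n x" "box_bump a b n x \<le> 1"
  unfolding box_bump_def
  by (auto intro!: prod_nonneg prod_le_1 mult_nonneg_nonneg mult_le_one flat_nonneg flat_0_le_1)

lemma box_bump_eq_0:
  assumes "x \<notin> box a b"
  shows "box_bump a b n x = 0"
proof -
  from assms obtain i where "i \<in> Basis" "x \<bullet> i \<le> a \<bullet> i \<or> b \<bullet> i \<le> x \<bullet> i"
    by (auto simp: mem_box not_less)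
  then show ?thesis
    unfolding box_bump_def by (auto simp: flat_def intro!: prod_zero bexI[of _ i])
qed

lemma flat_0_tendsto_1:
  assumes "t > 0"
  shows "(\<lambda>n. flat (1 / real (Suc n)) 0 t) \<longlonglongrightarrow> 1"
proof -
  have "(\<lambda>n. exp (- (1 / real (Suc n)) / t)) \<longlonglongrightarrow> exp (- 0 / t)"
    by (intro tendsto_intros LIMSEQ_Suc[OF lim_1_over_n]) (use assms in auto)
  then show ?thesis using assms by (simp add: flat_def)
qed

lemma box_bump_tendsto: "(\<lambda>n. box_bump a b n x) \<longlonglongrightarrow> indicator (box a b) x"
proof (cases "x \<in> box a b")
  case True
  then have "(\<lambda>n. box_bump a b n x) \<longlonglongrightarrow> (\<Prod>i\<in>(Basis::'a set). 1 * 1)"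
    unfolding box_bump_def by (intro tendsto_prod tendsto_mult flat_0_tendsto_1) (auto simp: mem_box)
  then show ?thesis using True by simp
qed (simp add: box_bump_eq_0)

lemma box_bump_test_function:
  assumes "cbox a b \<subseteq> U"
  shows "box_bump a b n \<in> test_functions U"
  unfolding test_functions_iff
proof
  show "smooth (box_bump a b n)"
    unfolding box_bump_def[abs_def]
    by (intro smooth_prod smooth_mult smooth_flat smooth_diff smooth_inner smooth_const) auto
  show "\<exists>K. compact K \<and> K \<subseteq> U \<and> (\<forall>x. x \<notin> K \<longrightarrow> box_bump a b n x = 0)"
    using assms box_bump_eq_0[of _ a b n] box_subset_cbox[of a b] by (intro exI[of _ "cbox a b"]) auto
qed

lemma integral_box_eq_0:
  fixes h :: "'a::euclidean_space \<Rightarrow> real"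
  assumes h: "integrable lborel h"
    and test: "\<And>n. (\<integral>x. h x * box_bump a b n x \<partial>lborel) = 0"
  shows "(\<integral>x. h x * indicator (box a b) x \<partial>lborel) = 0"
proof -
  have [measurable]: "h \<in> borel_measurable borel" using h by auto
  have [measurable]: "box_bump a b n \<in> borel_measurable borel" for n
    using box_bump_test_function[of a b UNIV n]
    by (auto intro!: borel_measurable_continuous_onI smooth_continuous simp: test_functions_iff)
  have "(\<lambda>n. \<integral>x. h x * box_bump a b n x \<partial>lborel) \<longlonglongrightarrow> (\<integral>x. h x * indicator (box a b) x \<partial>lborel)"
  proof (rule integral_dominated_convergence[where w="\<lambda>x. norm (h x)"])
    show "AE x in lborel. norm (h x * box_bump a b n x) \<le> norm (h x)" for n
      using box_bump_bounds[of a b n] by (auto simp: abs_mult intro!: mult_left_le)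
    show "AE x in lborel. (\<lambda>n. h x * box_bump a b n x) \<longlonglongrightarrow> h x * indicator (box a b) x"
      by (intro AE_I2 tendsto_intros box_bump_tendsto)
  qed (use h in auto)
  then show ?thesis by (simp add: test LIMSEQ_const_iff)
qed

text \<open>Boxes are stable under intersection and generate the Borel sets, so the pi-lambda
  argument extends the vanishing of the integrals of h from boxes to all Borel sets.\<close>

lemma AE_eq_0_of_boxes:
  fixes h :: "'a::euclidean_space \<Rightarrow> real"
  assumes h: "integrable lborel h"
    and boxes: "\<And>a b. (\<integral>x. h x * indicator (box a b) x \<partial>lborel) = 0"
  shows "AE x in lborel. h x = 0"
proof -
  have hm[measurable]: "h \<in> borel_measurable borel" using h by auto
  have int: "integrable lborel (\<lambda>x. h x * indicator A x)" if "A \<in> sets borel" for A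
    using integrable_mult_indicator[OF _ h, of A] that by (simp add: mult.commute)
  \<comment> \<open>The integral over the whole space is needed for closure under complements; it is
    the limit over an exhaustion by boxes.\<close>
  have UN: "(\<integral>x. h x \<partial>lborel) = 0"
  proof -
    have "(\<lambda>n. \<integral>x. h x * indicator (box (- (real n *\<^sub>R One)) (real n *\<^sub>R One)) x \<partial>lborel) \<longlonglongrightarrow> (\<integral>x. h x \<partial>lborel)"
    proof (rule integral_dominated_convergence[where w="\<lambda>x. norm (h x)"])
      show "AE x in lborel. (\<lambda>n. h x * indicator (box (- (real n *\<^sub>R One)) (real n *\<^sub>R One)) x) \<longlonglongrightarrow> h x"
      proof (rule AE_I2)
        fix x :: 'a
        obtain N where N: "x \<in> box (- (real N *\<^sub>R One)) (real N *\<^sub>R One)"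
          using UN_box_eq_UNIV[where 'a='a] by blast
        have "x \<in> box (- (real n *\<^sub>R One)) (real n *\<^sub>R One)" if "n \<ge> N" for n
          using N that by (force simp: mem_box)
        then have "\<forall>\<^sub>F n in sequentially. h x * indicator (box (- (real n *\<^sub>R One)) (real n *\<^sub>R One)) x = h x"
          unfolding eventually_sequentially by (intro exI[of _ N]) simp
        then show "(\<lambda>n. h x * indicator (box (- (real n *\<^sub>R One)) (real n *\<^sub>R One)) x) \<longlonglongrightarrow> h x"
          by (rule tendsto_eventually)
      qed
      show "AE x in lborel. norm (h x * indicator (box (- (real n *\<^sub>R One)) (real n *\<^sub>R One)) x) \<le> norm (h x)" for n
        by (auto simp: indicator_def)
    qed (use h in auto)
    then show ?thesis by (simp add: boxes LIMSEQ_const_iff)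
  qed
  have all: "(\<integral>x. h x * indicator A x \<partial>lborel) = 0" if "A \<in> sets borel" for A
  proof -
    have A: "A \<in> sigma_sets UNIV (range (\<lambda>(a, b). box a b))"
      using that by (simp add: borel_eq_box)
    have st: "Int_stable (range (\<lambda>(a, b). box a (b::'a)))"
      by (auto simp: Int_stable_def box_Int_box)
    have meas: "B \<in> sets borel" if "B \<in> sigma_sets UNIV (range (\<lambda>(a, b). box a (b::'a)))" for B
      using that by (simp add: borel_eq_box)
    show ?thesis
    proof (rule sigma_sets_induct_disjoint[OF st _ A])
      fix B assume B: "B \<in> sigma_sets UNIV (range (\<lambda>(a, b). box a (b::'a)))"
        and 0: "(\<integral>x. h x * indicator B x \<partial>lborel) = 0"
      have "(\<integral>x. h x * indicator (UNIV - B) x \<partial>lborel) = (\<integral>x. h x - h x * indicator B x \<partial>lborel)"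
        by (intro Bochner_Integration.integral_cong) (auto simp: indicator_def)
      also have "\<dots> = 0" using 0 UN int[OF meas[OF B]] h by simp
      finally show "(\<integral>x. h x * indicator (UNIV - B) x \<partial>lborel) = 0" .
    next
      fix B :: "nat \<Rightarrow> 'a set"
      assume dis: "disjoint_family B"
        and B: "range B \<subseteq> sigma_sets UNIV (range (\<lambda>(a, b). box a (b::'a)))"
        and 0: "\<And>i. (\<integral>x. h x * indicator (B i) x \<partial>lborel) = 0"
      have "B i \<in> sets borel" for i using B meas by blast
      then have "(\<integral>x\<in>(\<Union>i. B i). h x \<partial>lborel) = (\<Sum>i. (\<integral>x\<in>B i. h x \<partial>lborel))"
        using dis int[of "\<Union>i. B i"]
        by (intro lebesgue_integral_countable_add)
           (auto simp: set_integrable_def disjoint_family_on_def mult.commute)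
      then show "(\<integral>x. h x * indicator (\<Union>i. B i) x \<partial>lborel) = 0"
        using 0 by (simp add: set_lebesgue_integral_def mult.commute)
    qed (use boxes in auto)
  qed
  show ?thesis
    by (rule density_unique_real) (use h all in \<open>auto simp: set_lebesgue_integral_def mult.commute\<close>)
qed

text \<open>The claim is local. On a box with closure in U the function h is integrable, and limits
  of smooth bumps show that its integral over every subbox vanishes; countably many closed boxes
  then cover U.\<close>

lemma AE_eq_0_of_test_functions:
  fixes h :: "'a::euclidean_space \<Rightarrow> real"
  assumes U: "open U" and h: "square_integrable lebesgue h"
    and test: "\<And>\<psi>. \<psi> \<in> test_functions U \<Longrightarrow> (\<integral>x. h x * \<psi> x \<partial>lebesgue) = 0"
  shows "AE x in lebesgue. x \<in> U \<longrightarrow> h x = 0"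
proof -
  \<comment> \<open>The argument with boxes lives on Borel sets, so h is replaced by a Borel
    representative.\<close>
  obtain h' where h'[measurable]: "h' \<in> borel_measurable lborel" and eq: "AE x in lborel. h x = h' x"
    using completion_ex_borel_measurable_real[of h lborel] h by (auto simp: square_integrable_def)
  have eq': "AE x in lebesgue. h x = h' x" using eq by (rule AE_completion)
  have box: "AE x in lborel. x \<in> box a b \<longrightarrow> h' x = 0" if ab: "cbox a b \<subseteq> U" for a b
  proof -
    define k where "k x = h' x * indicator (box a b) x" for x
    have one: "square_integrable lebesgue (indicator (box a b) :: 'a \<Rightarrow> real)"
    proof -
      have "(indicator (box a b) :: 'a \<Rightarrow> real) \<in> borel_measurable lebesgue"
        by (intro measurable_completion) measurable
      moreover have "integrable lborel (indicator (box a b) :: 'a \<Rightarrow> real)"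
        by (intro integrable_real_indicator) (use emeasure_lborel_box_finite in auto)
      ultimately show ?thesis
        by (simp add: square_integrable_def integrable_completion power2_eq_square
            flip: indicator_inter_arith)
    qed
    have "integrable lebesgue (\<lambda>x. h x \<bullet> indicator (box a b) x)"
      by (rule integrable_inner_square_integrable[OF h one])
    then have "integrable lebesgue k"
      by (rule integrable_cong_AE_imp) (use eq' in \<open>auto simp: k_def[abs_def] intro!: measurable_completion\<close>)
    then have k: "integrable lborel k"
      by (subst (asm) integrable_completion) (auto simp: k_def[abs_def])
    have "(\<integral>x. k x * indicator (box c d) x \<partial>lborel) = 0" for c d
    proof -
      obtain c' d' where cd: "box a b \<inter> box c d = box c' d'"
        using box_Int_box[of a b c d] by blast
      have k_cd: "k x * indicator (box c d) x = k x * indicator (box c' d') x" for x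
      proof -
        have "x \<in> box c' d' \<longleftrightarrow> x \<in> box a b \<and> x \<in> box c d" using cd by blast
        then show ?thesis by (simp add: k_def split: split_indicator)
      qed
      show ?thesis
      \<comment> \<open>An empty open box may have a non-empty closed counterpart lying outside U.
        Only for a non-empty box is \<open>cbox c' d'\<close> the closure of
        \<open>box c' d'\<close> and hence inside U, so that the bumps are test functions.\<close>
      proof (cases "box c' d' = {}")
        case True
        then show ?thesis by (simp add: k_cd)
      next
        case False
        have "closure (box c' d') \<subseteq> closure (box a b)"
          using cd by (intro closure_mono) blast
        then have sub: "cbox c' d' \<subseteq> U"
          using False ab closure_minimal[OF box_subset_cbox closed_cbox, of a b] by simp
        have "(\<integral>x. k x * box_bump c' d' n x \<partial>lborel) = 0" for n
        proof -
          note \<psi> = box_bump_test_function[OF sub, of n]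
          have m: "box_bump c' d' n \<in> borel_measurable borel"
            using \<psi> by (auto intro!: borel_measurable_continuous_onI smooth_continuous simp: test_functions_iff)
          have "(\<integral>x. k x * box_bump c' d' n x \<partial>lborel) = (\<integral>x. k x * box_bump c' d' n x \<partial>lebesgue)"
            using m by (intro integral_completion[symmetric]) (simp add: k_def[abs_def])
          also have "\<dots> = (\<integral>x. h x * box_bump c' d' n x \<partial>lebesgue)"
          proof (rule integral_cong_AE)
            show "AE x in lebesgue. k x * box_bump c' d' n x = h x * box_bump c' d' n x"
              using eq'
            proof eventually_elim
              case (elim x)
              have "x \<in> box c' d' \<Longrightarrow> x \<in> box a b" using cd by blast
              with elim show ?case
                using box_bump_eq_0[of x c' d' n] by (cases "x \<in> box c' d'") (simp_all add: k_def)
            qed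
            show "(\<lambda>x. k x * box_bump c' d' n x) \<in> borel_measurable lebesgue"
              using m by (intro measurable_completion) (simp add: k_def[abs_def])
            show "(\<lambda>x. h x * box_bump c' d' n x) \<in> borel_measurable lebesgue"
              using measurable_completion[of _ lborel borel] m square_integrable_measurable[OF h]
              by (intro borel_measurable_times) auto
          qed
          also have "\<dots> = 0" by (rule test[OF \<psi>])
          finally show ?thesis .
        qed
        from integral_box_eq_0[OF k this] show ?thesis by (simp add: k_cd)
      qed
    qed
    then have "AE x in lborel. k x = 0" by (rule AE_eq_0_of_boxes[OF k])
    then show ?thesis by eventually_elim (auto simp: k_def)
  qed
  \<comment> \<open>An open set is a countable union of closed boxes; passing from the open to the
    closed box adds only its faces, which are negligible.\<close>
  have cbox: "AE x in lebesgue. x \<in> cbox a b \<longrightarrow> h x = 0" if "cbox a b \<subseteq> U" for a b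
  proof -
    have "AE x in lebesgue. x \<notin> cbox a b - box a b"
      by (intro AE_not_in) (use negligible_frontier_interval in \<open>simp add: negligible_iff_null_sets\<close>)
    with eq' AE_completion[OF box[OF that]] show ?thesis
      by eventually_elim auto
  qed
  obtain D where D: "countable D" "\<And>X. X \<in> D \<Longrightarrow> \<exists>a b. X = cbox a b" "\<Union>D = U"
    using open_countable_Union_open_cbox[OF U] by metis
  have "AE x in lebesgue. \<forall>X\<in>D. x \<in> X \<longrightarrow> h x = 0"
    using D by (subst AE_ball_countable[OF D(1)]) (metis Union_upper cbox)
  then show ?thesis
    by eventually_elim (use D(3) in blast)
qed

subsection \<open>Limits of test functions\<close>

text \<open>Carrying the gradient along as a second component means that enlarging the domain leaves
  the pair unchanged, and that compositions are handled by the classical chain rule on test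
  functions.\<close>

definition H10_limit :: "'a::euclidean_space set \<Rightarrow> ('a \<Rightarrow> real) \<Rightarrow> ('a \<Rightarrow> 'a) \<Rightarrow> bool" where
  "H10_limit U f g \<longleftrightarrow> (\<exists>\<psi>. (\<forall>n. \<psi> n \<in> test_functions U) \<and>
     L2_conv lebesgue \<psi> f \<and> L2_conv lebesgue (\<lambda>n. grad (\<psi> n)) g)"

lemma test_function_zero_outside:
  assumes "\<psi> \<in> test_functions U" "x \<notin> U"
  shows "\<psi> x = 0" "grad \<psi> x = 0"
proof -
  obtain K where "K \<subseteq> U" "\<And>x. x \<notin> K \<Longrightarrow> \<psi> x = 0" "\<And>x. x \<notin> K \<Longrightarrow> grad \<psi> x = 0"
    by (rule test_functionE[OF assms(1)]) metis
  then show "\<psi> x = 0" "grad \<psi> x = 0" using assms(2) by auto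
qed

lemma test_functions_mono: "U \<subseteq> V \<Longrightarrow> test_functions U \<subseteq> test_functions V"
  by (auto simp: test_functions_def)

lemma H10_limit_mono: "U \<subseteq> V \<Longrightarrow> H10_limit U f g \<Longrightarrow> H10_limit V f g"
  unfolding H10_limit_def using test_functions_mono by blast

lemma H10_limit_square_integrable:
  assumes "H10_limit U f g"
  shows "square_integrable lebesgue f" "square_integrable lebesgue g"
  using assms unfolding H10_limit_def
  by (meson L2_conv_square_integrable test_function_square_integrable)+

lemma H10_limit_zero_outside:
  assumes "H10_limit U f g"
  shows "AE x in lebesgue. x \<notin> U \<longrightarrow> f x = 0 \<and> g x = 0"
proof -
  obtain \<psi> where \<psi>: "\<And>n. \<psi> n \<in> test_functions U" "L2_conv lebesgue \<psi> f" "L2_conv lebesgue (\<lambda>n. grad (\<psi> n)) g"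
    using assms unfolding H10_limit_def by blast
  have "\<psi> n x = 0 \<and> grad (\<psi> n) x = 0" if "x \<in> - U" for n x
    using test_function_zero_outside[OF \<psi>(1)[of n]] that by simp
  then have "AE x in lebesgue. x \<in> - U \<longrightarrow> f x = 0" "AE x in lebesgue. x \<in> - U \<longrightarrow> g x = 0"
    using L2_conv_AE_zero[OF \<psi>(2), of "- U"] L2_conv_AE_zero[OF \<psi>(3), of "- U"] by blast+
  then show ?thesis by eventually_elim auto
qed

lemma H10_limit_cong_AE:
  assumes "H10_limit U f g" "AE x in lebesgue. f x = f' x" "AE x in lebesgue. g x = g' x"
    "f' \<in> borel_measurable lebesgue" "g' \<in> borel_measurable lebesgue"
  shows "H10_limit U f' g'"
proof -
  obtain \<psi> where \<psi>: "\<forall>n. \<psi> n \<in> test_functions U" "L2_conv lebesgue \<psi> f" "L2_conv lebesgue (\<lambda>n. grad (\<psi> n)) g"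
    using assms(1) unfolding H10_limit_def by blast
  show ?thesis
    unfolding H10_limit_def
    using \<psi>(1) L2_conv_cong_AE[OF \<psi>(2) assms(2,4)] L2_conv_cong_AE[OF \<psi>(3) assms(3,5)]
    by (intro exI[of _ \<psi>] conjI)
qed

section \<open>Translation between functions on U and their zero extensions\<close>

definition zero_extension :: "'a set \<Rightarrow> ('a \<Rightarrow> 'b::zero) \<Rightarrow> 'a \<Rightarrow> 'b" where
  "zero_extension U f x = (if x \<in> U then f x else 0)"

lemma zero_extension_simps [simp]:
  "x \<in> U \<Longrightarrow> zero_extension U f x = f x" "x \<notin> U \<Longrightarrow> zero_extension U f x = 0"
  by (auto simp: zero_extension_def)

lemma L2_on_iff:
  assumes "open U"
  shows "f \<in> L2_on U \<longleftrightarrow> square_integrable lebesgue (zero_extension U f)"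
proof -
  have U: "U \<in> sets lebesgue" using assms by simp
  have *: "(\<lambda>x. (norm (zero_extension U f x))\<^sup>2) = (\<lambda>x. if x \<in> U then (norm (f x))\<^sup>2 else 0)"
    by (auto simp: zero_extension_def)
  show ?thesis
    unfolding L2_on_def square_integrable_def * mem_Collect_eq
      Lebesgue_Measure.integrable_restrict_UNIV[OF U]
    by (simp add: zero_extension_def[abs_def] borel_measurable_if[OF U])
qed

lemma integral_lebesgue_on:
  fixes f :: "'a::euclidean_space \<Rightarrow> real"
  assumes "open U" "\<And>x. x \<in> U \<Longrightarrow> f x = f' x" "\<And>x. x \<notin> U \<Longrightarrow> f' x = 0"
  shows "integral\<^sup>L (lebesgue_on U) f = integral\<^sup>L lebesgue f'"
    "integrable (lebesgue_on U) f \<longleftrightarrow> integrable lebesgue f'"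
proof -
  have U: "U \<in> sets lebesgue" using assms by simp
  have "f' = (\<lambda>x. if x \<in> U then f x else 0)" using assms by auto
  then show "integral\<^sup>L (lebesgue_on U) f = integral\<^sup>L lebesgue f'"
    "integrable (lebesgue_on U) f \<longleftrightarrow> integrable lebesgue f'"
    using Lebesgue_Measure.integral_restrict_UNIV[OF U, of f]
      Lebesgue_Measure.integrable_restrict_UNIV[OF U, of f] by simp_all
qed

lemma has_weak_gradient_iff:
  assumes "open U"
  shows "has_weak_gradient f g U \<longleftrightarrow> (\<forall>\<psi>\<in>test_functions U. \<forall>i\<in>Basis.
      (\<integral>x. zero_extension U f x * partial \<psi> i x \<partial>lebesgue) =
      - (\<integral>x. (zero_extension U g x \<bullet> i) * \<psi> x \<partial>lebesgue))"
proof -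
  have 1: "integral\<^sup>L (lebesgue_on U) (\<lambda>x. f x * frechet_derivative \<psi> (at x) i) =
      (\<integral>x. zero_extension U f x * partial \<psi> i x \<partial>lebesgue)" for \<psi> i
    by (rule integral_lebesgue_on[OF assms]) (auto simp: partial_def)
  have 2: "integral\<^sup>L (lebesgue_on U) (\<lambda>x. (g x \<bullet> i) * \<psi> x) =
      (\<integral>x. (zero_extension U g x \<bullet> i) * \<psi> x \<partial>lebesgue)" for \<psi> i
    by (rule integral_lebesgue_on[OF assms]) auto
  show ?thesis unfolding has_weak_gradient_def 1 2 ..
qed

lemma square_integrable_inner_const:
  assumes "square_integrable M g"
  shows "square_integrable M (\<lambda>x. g x \<bullet> i)"
proof -
  note [measurable] = square_integrable_measurable[OF assms]
  have "integrable M (\<lambda>x. (norm i)\<^sup>2 * (norm (g x))\<^sup>2)"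
    using assms by (simp add: square_integrable_def)
  then have "integrable M (\<lambda>x. (norm (g x \<bullet> i))\<^sup>2)"
  proof (rule Bochner_Integration.integrable_bound)
    have "(g x \<bullet> i)\<^sup>2 \<le> (norm i * norm (g x))\<^sup>2" for x
      using Cauchy_Schwarz_ineq2[of "g x" i] by (intro power2_le_iff_abs_le[THEN iffD2]) (auto simp: mult.commute)
    then show "AE x in M. norm ((norm (g x \<bullet> i))\<^sup>2) \<le> norm ((norm i)\<^sup>2 * (norm (g x))\<^sup>2)"
      by (simp add: power_mult_distrib)
  qed measurable
  then show ?thesis by (simp add: square_integrable_def)
qed

text \<open>Subtracting the two defining identities leaves each component of g - h orthogonal to all
  test functions.\<close>

lemma weak_gradient_unique:
  fixes f :: "'a::euclidean_space \<Rightarrow> real"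
  assumes U: "open U" and g: "g \<in> L2_on U" "has_weak_gradient f g U"
    and h: "h \<in> L2_on U" "has_weak_gradient f h U"
  shows "AE x in lebesgue. x \<in> U \<longrightarrow> g x = h x"
proof -
  let ?g = "zero_extension U g" and ?h = "zero_extension U h"
  have sq: "square_integrable lebesgue ?g" "square_integrable lebesgue ?h"
    using g h by (simp_all add: L2_on_iff[OF U])
  have "AE x in lebesgue. x \<in> U \<longrightarrow> (?g x - ?h x) \<bullet> i = 0" if i: "i \<in> Basis" for i
  proof (rule AE_eq_0_of_test_functions[OF U])
    show "square_integrable lebesgue (\<lambda>x. (?g x - ?h x) \<bullet> i)"
      by (intro square_integrable_inner_const square_integrable_diff sq)
    fix \<psi> assume \<psi>: "\<psi> \<in> test_functions U"
    have int: "integrable lebesgue (\<lambda>x. (k x \<bullet> i) * \<psi> x)" if "square_integrable lebesgue k" for k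
      using integrable_inner_square_integrable[OF square_integrable_inner_const[OF that]
          test_function_square_integrable(1)[OF \<psi>], of i] by simp
    have "(\<integral>x. (?g x \<bullet> i) * \<psi> x \<partial>lebesgue) = (\<integral>x. (?h x \<bullet> i) * \<psi> x \<partial>lebesgue)"
      using g h \<psi> i by (auto simp: has_weak_gradient_iff[OF U])
    then show "(\<integral>x. ((?g x - ?h x) \<bullet> i) * \<psi> x \<partial>lebesgue) = 0"
      using int[OF sq(1)] int[OF sq(2)] by (simp add: inner_diff_left left_diff_distrib)
  qed
  then have "AE x in lebesgue. \<forall>i\<in>Basis. x \<in> U \<longrightarrow> (?g x - ?h x) \<bullet> i = 0"
    by (subst AE_ball_countable) (auto intro: countable_finite)
  then show ?thesis
  proof eventually_elim
    case (elim x)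
    show ?case
    proof
      assume "x \<in> U"
      then show "g x = h x"
        using elim euclidean_all_zero_iff[of "?g x - ?h x"] by simp
    qed
  qed
qed

lemma weak_gradient_AE:
  assumes U: "open U" and g: "g \<in> L2_on U" "has_weak_gradient f g U"
  shows "weak_gradient U f \<in> L2_on U" "has_weak_gradient f (weak_gradient U f) U"
    "AE x in lebesgue. x \<in> U \<longrightarrow> weak_gradient U f x = g x"
proof -
  have "weak_gradient U f \<in> L2_on U \<and> has_weak_gradient f (weak_gradient U f) U"
    unfolding weak_gradient_def by (rule someI[of _ g]) (use g in auto)
  then show "weak_gradient U f \<in> L2_on U" "has_weak_gradient f (weak_gradient U f) U" by auto
  then show "AE x in lebesgue. x \<in> U \<longrightarrow> weak_gradient U f x = g x"
    using weak_gradient_unique[OF U _ _ g] by blast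
qed

lemma zero_extension_test_function:
  assumes "\<psi> \<in> test_functions U"
  shows "zero_extension U \<psi> = \<psi>" "zero_extension U (grad \<psi>) = grad \<psi>"
proof -
  show "zero_extension U \<psi> = \<psi>" "zero_extension U (grad \<psi>) = grad \<psi>"
    using test_function_zero_outside[OF assms] by (auto simp: zero_extension_def fun_eq_iff)
qed

lemma test_function_L2_on:
  assumes "open U" "\<psi> \<in> test_functions U"
  shows "\<psi> \<in> L2_on U" "grad \<psi> \<in> L2_on U"
  using assms
  by (simp_all add: L2_on_iff zero_extension_test_function
      test_function_square_integrable[OF assms(2)])

lemma test_function_has_weak_gradient:
  assumes U: "open U" and \<psi>: "\<psi> \<in> test_functions U"
  shows "has_weak_gradient \<psi> (grad \<psi>) U"
  unfolding has_weak_gradient_iff[OF U]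
  using \<psi> by (auto simp: zero_extension_test_function grad_inner test_functions_iff
      intro!: integration_by_parts)

lemma L2_on_diff:
  assumes "open U" "f \<in> L2_on U" "g \<in> L2_on U"
  shows "(\<lambda>x. f x - g x) \<in> L2_on U"
proof -
  have "zero_extension U (\<lambda>x. f x - g x) = (\<lambda>x. zero_extension U f x - zero_extension U g x)"
    by (auto simp: zero_extension_def)
  then show ?thesis using assms by (simp add: L2_on_iff square_integrable_diff)
qed

lemma has_weak_gradient_diff:
  assumes U: "open U" and f: "f \<in> L2_on U" "f' \<in> L2_on U" "has_weak_gradient f f' U"
    and g: "g \<in> L2_on U" "g' \<in> L2_on U" "has_weak_gradient g g' U"
  shows "has_weak_gradient (\<lambda>x. f x - g x) (\<lambda>x. f' x - g' x) U"
  unfolding has_weak_gradient_iff[OF U]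
proof (intro ballI)
  fix \<psi> and i :: 'a assume \<psi>: "\<psi> \<in> test_functions U" and i: "i \<in> Basis"
  note t = test_function_square_integrable[OF \<psi>]
  have 1: "integrable lebesgue (\<lambda>x. zero_extension U k x * partial \<psi> i x)" if "k \<in> L2_on U" for k
    using integrable_inner_square_integrable[OF _ t(2)[OF i]] that by (simp add: L2_on_iff[OF U])
  have 2: "integrable lebesgue (\<lambda>x. (zero_extension U k x \<bullet> i) * \<psi> x)" if "k \<in> L2_on U" for k
    using integrable_inner_square_integrable[OF square_integrable_inner_const t(1)] that
    by (simp add: L2_on_iff[OF U])
  have z: "zero_extension U (\<lambda>x. p x - q x) = (\<lambda>x. zero_extension U p x - zero_extension U q x)"
    for p q :: "'a \<Rightarrow> 'c::real_vector"
    by (auto simp: zero_extension_def)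
  show "(\<integral>x. zero_extension U (\<lambda>x. f x - g x) x * partial \<psi> i x \<partial>lebesgue) =
      - (\<integral>x. (zero_extension U (\<lambda>x. f' x - g' x) x \<bullet> i) * \<psi> x \<partial>lebesgue)"
    using f g \<psi> i 1[OF f(1)] 1[OF g(1)] 2[OF f(2)] 2[OF g(2)]
    by (simp add: z left_diff_distrib inner_diff_left has_weak_gradient_iff[OF U])
qed

text \<open>Integration by parts holds for the smooth approximations and passes to the limit, both
  sides being inner products with a fixed square integrable function; for the gradients this is the
  vector field \<eta> times i.\<close>

lemma H10_limit_has_weak_gradient:
  assumes U: "open U" and lim: "H10_limit U (zero_extension U f) (zero_extension U g)"
  shows "f \<in> L2_on U" "g \<in> L2_on U" "has_weak_gradient f g U"
proof -
  show L2: "f \<in> L2_on U" "g \<in> L2_on U"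
    using H10_limit_square_integrable[OF lim] by (simp_all add: L2_on_iff[OF U])
  obtain \<psi> where \<psi>: "\<And>n. \<psi> n \<in> test_functions U" "L2_conv lebesgue \<psi> (zero_extension U f)"
    "L2_conv lebesgue (\<lambda>n. grad (\<psi> n)) (zero_extension U g)"
    using lim unfolding H10_limit_def by blast
  show "has_weak_gradient f g U"
    unfolding has_weak_gradient_iff[OF U]
  proof (intro ballI)
    fix \<eta> and i :: 'a assume \<eta>: "\<eta> \<in> test_functions U" and i: "i \<in> Basis"
    note t = test_function_square_integrable[OF \<eta>]
    have 1: "(\<lambda>n. \<integral>x. \<psi> n x * partial \<eta> i x \<partial>lebesgue) \<longlonglongrightarrow> (\<integral>x. zero_extension U f x * partial \<eta> i x \<partial>lebesgue)"
      using L2_conv_integral_inner[OF \<psi>(2) test_function_square_integrable(1)[OF \<psi>(1)] t(2)[OF i]] by simp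
    have sq: "square_integrable lebesgue (\<lambda>x. \<eta> x *\<^sub>R i)"
      using t(1) by (simp add: square_integrable_def power_mult_distrib borel_measurable_scaleR)
    have 2: "(\<lambda>n. \<integral>x. partial (\<psi> n) i x * \<eta> x \<partial>lebesgue) \<longlonglongrightarrow> (\<integral>x. (zero_extension U g x \<bullet> i) * \<eta> x \<partial>lebesgue)"
      using L2_conv_integral_inner[OF \<psi>(3) test_function_square_integrable(3)[OF \<psi>(1)] sq]
      by (simp add: grad_inner[OF i] mult.commute)
    have "(\<integral>x. \<psi> n x * partial \<eta> i x \<partial>lebesgue) = - (\<integral>x. partial (\<psi> n) i x * \<eta> x \<partial>lebesgue)" for n
      using \<psi>(1)[of n] by (intro integration_by_parts[OF \<eta> _ i]) (simp add: test_functions_iff)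
    then show "(\<integral>x. zero_extension U f x * partial \<eta> i x \<partial>lebesgue) = - (\<integral>x. (zero_extension U g x \<bullet> i) * \<eta> x \<partial>lebesgue)"
      using LIMSEQ_unique[OF 1] tendsto_minus[OF 2] by simp
  qed
qed

lemma L2_on_norm_sq:
  assumes "open U" "f \<in> L2_on U"
  shows "ennreal (integral\<^sup>L (lebesgue_on U) (\<lambda>x. (norm (f x))\<^sup>2)) =
    (\<integral>\<^sup>+x. ennreal ((norm (zero_extension U f x))\<^sup>2) \<partial>lebesgue)"
proof -
  have "integral\<^sup>L (lebesgue_on U) (\<lambda>x. (norm (f x))\<^sup>2) = integral\<^sup>L lebesgue (\<lambda>x. (norm (zero_extension U f x))\<^sup>2)"
    by (rule integral_lebesgue_on[OF assms(1)]) auto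
  then show ?thesis
    using assms by (simp add: L2_on_iff square_integrable_def nn_integral_eq_integral)
qed

text \<open>Both terms under the root in \<open>H1_norm\<close> tend to 0, and the gradient term is the \<open>L\<^sup>2\<close> distance
  of the classical gradients to the weak one.\<close>

lemma H1_norm_tendsto_0_iff:
  assumes U: "open U" and \<psi>: "\<And>n. \<psi> n \<in> test_functions U"
    and f: "f \<in> L2_on U" "g \<in> L2_on U" "has_weak_gradient f g U"
  shows "(\<lambda>n. H1_norm U (\<lambda>x. f x - \<psi> n x)) \<longlonglongrightarrow> 0 \<longleftrightarrow>
    L2_conv lebesgue \<psi> (zero_extension U f) \<and> L2_conv lebesgue (\<lambda>n. grad (\<psi> n)) (zero_extension U g)"
proof -
  define A where "A n = integral\<^sup>L (lebesgue_on U) (\<lambda>x. (f x - \<psi> n x)\<^sup>2)" for n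
  define B where "B n = integral\<^sup>L (lebesgue_on U) (\<lambda>x. (norm (weak_gradient U (\<lambda>x. f x - \<psi> n x) x))\<^sup>2)" for n
  have nonneg: "A n \<ge> 0" "B n \<ge> 0" for n by (simp_all add: A_def B_def)
  note t = test_function_L2_on[OF U \<psi>]
  have A: "ennreal (A n) = (\<integral>\<^sup>+x. ennreal ((norm (\<psi> n x - zero_extension U f x))\<^sup>2) \<partial>lebesgue)" for n
  proof -
    have "ennreal (A n) = (\<integral>\<^sup>+x. ennreal ((norm (zero_extension U (\<lambda>x. f x - \<psi> n x) x))\<^sup>2) \<partial>lebesgue)"
      using L2_on_norm_sq[OF U L2_on_diff[OF U f(1) t(1)[of n]]] by (simp add: A_def)
    also have "(\<lambda>x. ennreal ((norm (zero_extension U (\<lambda>x. f x - \<psi> n x) x))\<^sup>2)) =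
        (\<lambda>x. ennreal ((norm (\<psi> n x - zero_extension U f x))\<^sup>2))"
    proof
      fix x
      show "ennreal ((norm (zero_extension U (\<lambda>x. f x - \<psi> n x) x))\<^sup>2) =
          ennreal ((norm (\<psi> n x - zero_extension U f x))\<^sup>2)"
        using fun_cong[OF zero_extension_test_function(1)[OF \<psi>[of n]], of x]
        by (cases "x \<in> U") (auto simp: power2_commute)
    qed
    finally show ?thesis .
  qed
  have B: "ennreal (B n) = (\<integral>\<^sup>+x. ennreal ((norm (grad (\<psi> n) x - zero_extension U g x))\<^sup>2) \<partial>lebesgue)" for n
  proof -
    note wg = weak_gradient_AE[OF U L2_on_diff[OF U f(2) t(2)[of n]]
        has_weak_gradient_diff[OF U f t(1)[of n] t(2)[of n] test_function_has_weak_gradient[OF U \<psi>[of n]]]]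
    have "ennreal (B n) = (\<integral>\<^sup>+x. ennreal ((norm (zero_extension U (weak_gradient U (\<lambda>x. f x - \<psi> n x)) x))\<^sup>2) \<partial>lebesgue)"
      using L2_on_norm_sq[OF U wg(1)] by (simp add: B_def)
    also have "\<dots> = (\<integral>\<^sup>+x. ennreal ((norm (grad (\<psi> n) x - zero_extension U g x))\<^sup>2) \<partial>lebesgue)"
    proof (rule nn_integral_cong_AE, use wg(3) in eventually_elim)
      case (elim x)
      then show ?case
        using fun_cong[OF zero_extension_test_function(2)[OF \<psi>[of n]], of x]
        by (cases "x \<in> U") (auto simp: norm_minus_commute)
    qed
    finally show ?thesis .
  qed
  have "(\<lambda>n. sqrt (A n + B n)) \<longlonglongrightarrow> 0 \<longleftrightarrow> (\<lambda>n. A n + B n) \<longlonglongrightarrow> 0"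
  proof
    assume "(\<lambda>n. sqrt (A n + B n)) \<longlonglongrightarrow> 0"
    from tendsto_power[OF this, of 2] show "(\<lambda>n. A n + B n) \<longlonglongrightarrow> 0"
      using nonneg by simp
  next
    assume "(\<lambda>n. A n + B n) \<longlonglongrightarrow> 0"
    from tendsto_real_sqrt[OF this] show "(\<lambda>n. sqrt (A n + B n)) \<longlonglongrightarrow> 0" by simp
  qed
  also have "\<dots> \<longleftrightarrow> A \<longlonglongrightarrow> 0 \<and> B \<longlonglongrightarrow> 0"
  proof (intro iffI conjI)
    assume *: "(\<lambda>n. A n + B n) \<longlonglongrightarrow> 0"
    show "A \<longlonglongrightarrow> 0" "B \<longlonglongrightarrow> 0"
      by (rule tendsto_sandwich[OF _ _ tendsto_const *]; simp add: nonneg)+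
  qed (use tendsto_add[of A 0 _ B 0] in auto)
  also have "\<dots> \<longleftrightarrow> (\<lambda>n. ennreal (A n)) \<longlonglongrightarrow> 0 \<and> (\<lambda>n. ennreal (B n)) \<longlonglongrightarrow> 0"
    using nonneg by (simp add: ennreal_tendsto_0_iff)
  also have "\<dots> \<longleftrightarrow> L2_conv lebesgue \<psi> (zero_extension U f) \<and> L2_conv lebesgue (\<lambda>n. grad (\<psi> n)) (zero_extension U g)"
    unfolding A B L2_conv_def
    using test_function_square_integrable[OF \<psi>] f
    by (auto simp: square_integrable_def L2_on_iff[OF U])
  finally show ?thesis by (simp add: H1_norm_def A_def B_def)
qed

lemma H10_imp_H10_limit:
  assumes U: "open U" and f: "f \<in> H10 U"
  shows "H10_limit U (zero_extension U f) (zero_extension U (weak_gradient U f))"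
proof -
  from f obtain g \<psi> where g: "f \<in> L2_on U" "g \<in> L2_on U" "has_weak_gradient f g U"
    and \<psi>: "\<And>n. \<psi> n \<in> test_functions U" "(\<lambda>n. H1_norm U (\<lambda>x. f x - \<psi> n x)) \<longlonglongrightarrow> 0"
    unfolding H10_def H1_def by blast
  show ?thesis
    using H1_norm_tendsto_0_iff[OF U \<psi>(1) g(1) weak_gradient_AE(1,2)[OF U g(2,3)]] \<psi>
    unfolding H10_limit_def by (intro exI[of _ \<psi>]) simp
qed

text \<open>Such f and g vanish outside U only almost everywhere. They are first changed on a null
  set into exact zero extensions, to which the translation applies.\<close>

lemma H10_limit_imp_H10:
  assumes U: "open U" and lim: "H10_limit U f g"
  shows "f \<in> H10 U" "AE x in lebesgue. x \<in> U \<longrightarrow> weak_gradient U f x = g x"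
proof -
  have z: "AE x in lebesgue. k x = zero_extension U k x" "zero_extension U k \<in> borel_measurable lebesgue"
    if "AE x in lebesgue. x \<notin> U \<longrightarrow> k x = 0" "k \<in> borel_measurable lebesgue" for k :: "'a \<Rightarrow> 'b::euclidean_space"
  proof -
    show "AE x in lebesgue. k x = zero_extension U k x"
      using that(1) by eventually_elim (auto simp: zero_extension_def)
    show "zero_extension U k \<in> borel_measurable lebesgue"
      unfolding zero_extension_def[abs_def] using that(2) U
      by (intro measurable_If_set) auto
  qed
  note sq = H10_limit_square_integrable[OF lim, THEN square_integrable_measurable]
  have "AE x in lebesgue. x \<notin> U \<longrightarrow> f x = 0" "AE x in lebesgue. x \<notin> U \<longrightarrow> g x = 0"
    using H10_limit_zero_outside[OF lim] by (auto elim: eventually_mono)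
  from z[OF this(1) sq(1)] z[OF this(2) sq(2)]
  have lim': "H10_limit U (zero_extension U f) (zero_extension U g)"
    by (intro H10_limit_cong_AE[OF lim])
  note wg = H10_limit_has_weak_gradient[OF U lim']
  show "AE x in lebesgue. x \<in> U \<longrightarrow> weak_gradient U f x = g x"
    by (rule weak_gradient_AE[OF U wg(2,3)])
  show "f \<in> H10 U"
  proof -
    obtain \<psi> where \<psi>: "\<And>n. \<psi> n \<in> test_functions U" "L2_conv lebesgue \<psi> (zero_extension U f)"
      "L2_conv lebesgue (\<lambda>n. grad (\<psi> n)) (zero_extension U g)"
      using lim' unfolding H10_limit_def by blast
    then have "(\<lambda>n. H1_norm U (\<lambda>x. f x - \<psi> n x)) \<longlonglongrightarrow> 0"
      using H1_norm_tendsto_0_iff[OF U \<psi>(1) wg] by simp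
    moreover have "f \<in> H1 U" using wg unfolding H1_def by blast
    ultimately show ?thesis using \<psi>(1) unfolding H10_def by blast
  qed
qed

subsection \<open>Variational solutions\<close>

text \<open>Testing with pairs (v, h) makes the equation applicable to any v obtained as a limit of
  test functions, without identifying its weak gradient.\<close>

definition H10_solution :: "'a::euclidean_space set \<Rightarrow> real \<Rightarrow> ('a \<Rightarrow> real) \<Rightarrow> ('a \<Rightarrow> 'a) \<Rightarrow> bool" where
  "H10_solution U c f g \<longleftrightarrow> H10_limit U f g \<and>
     (\<forall>v h. H10_limit U v h \<longrightarrow> integrable lebesgue (\<lambda>x. exp (- f x) * v x) \<and>
        (\<integral>x. g x \<bullet> h x \<partial>lebesgue) = c * (\<integral>x. exp (- f x) * v x \<partial>lebesgue))"

lemma variational_solution_imp_H10_solution: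
  assumes U: "open U" and \<phi>: "variational_solution U c \<phi>"
  shows "H10_solution U c (zero_extension U \<phi>) (zero_extension U (weak_gradient U \<phi>))"
  unfolding H10_solution_def
proof (intro conjI allI impI)
  have "\<phi> \<in> H10 U" using \<phi> by (simp add: variational_solution_def)
  from H10_imp_H10_limit[OF U this]
  show lim: "H10_limit U (zero_extension U \<phi>) (zero_extension U (weak_gradient U \<phi>))" .
  fix v h assume vh: "H10_limit U v h"
  note v = H10_limit_imp_H10[OF U vh]
  note [measurable] = H10_limit_square_integrable[OF lim, THEN square_integrable_measurable]
    H10_limit_square_integrable[OF vh, THEN square_integrable_measurable]
    H10_limit_square_integrable[OF H10_imp_H10_limit[OF U v(1)], THEN square_integrable_measurable]
  have int: "integrable (lebesgue_on U) (\<lambda>x. exp (- \<phi> x) * v x)"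
    and eq: "integral\<^sup>L (lebesgue_on U) (\<lambda>x. weak_gradient U \<phi> x \<bullet> weak_gradient U v x) =
        c * integral\<^sup>L (lebesgue_on U) (\<lambda>x. exp (- \<phi> x) * v x)"
    using \<phi> v(1) by (auto simp: variational_solution_def)
  let ?E = "\<lambda>x. exp (- zero_extension U \<phi> x) * zero_extension U v x"
  have E: "integral\<^sup>L (lebesgue_on U) (\<lambda>x. exp (- \<phi> x) * v x) = integral\<^sup>L lebesgue ?E"
    "integrable (lebesgue_on U) (\<lambda>x. exp (- \<phi> x) * v x) \<longleftrightarrow> integrable lebesgue ?E"
    by (rule integral_lebesgue_on[OF U]; simp)+
  have ae: "AE x in lebesgue. ?E x = exp (- zero_extension U \<phi> x) * v x"
    using H10_limit_zero_outside[OF vh] by eventually_elim (auto simp: zero_extension_def)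
  show "integrable lebesgue (\<lambda>x. exp (- zero_extension U \<phi> x) * v x)"
    by (rule integrable_cong_AE_imp[of _ ?E]) (use int E ae in \<open>auto intro!: measurable_completion\<close>)
  have "(\<integral>x. exp (- zero_extension U \<phi> x) * v x \<partial>lebesgue) = integral\<^sup>L lebesgue ?E"
    by (rule integral_cong_AE) (use ae in auto)
  moreover have "integral\<^sup>L (lebesgue_on U) (\<lambda>x. weak_gradient U \<phi> x \<bullet> weak_gradient U v x) =
      (\<integral>x. zero_extension U (weak_gradient U \<phi>) x \<bullet> zero_extension U (weak_gradient U v) x \<partial>lebesgue)"
    by (rule integral_lebesgue_on[OF U]) auto
  moreover have "\<dots> = (\<integral>x. zero_extension U (weak_gradient U \<phi>) x \<bullet> h x \<partial>lebesgue)"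
  proof (rule integral_cong_AE)
    show "AE x in lebesgue. zero_extension U (weak_gradient U \<phi>) x \<bullet> zero_extension U (weak_gradient U v) x =
        zero_extension U (weak_gradient U \<phi>) x \<bullet> h x"
      using v(2) by eventually_elim (auto simp: zero_extension_def)
  qed measurable
  ultimately show "(\<integral>x. zero_extension U (weak_gradient U \<phi>) x \<bullet> h x \<partial>lebesgue) =
      c * (\<integral>x. exp (- zero_extension U \<phi> x) * v x \<partial>lebesgue)"
    using eq E by simp
qed

subsection \<open>Comparison\<close>

text \<open>The chain rule in the limit. The values converge because \<open>soft c\<close> is
  1-Lipschitz; the subsequence is for the gradients, where \<open>soft' c\<close> is only continuous
  and bounded and needs pointwise convergence of its argument. Square integrability is asked of g
  but not of f, which leaves room for a shift by a constant.\<close>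

lemma L2_conv_soft:
  assumes c: "c > 0" and p: "\<And>n. smooth (p n)" "L2_conv lebesgue p f"
    "L2_conv lebesgue (\<lambda>n. grad (p n)) g" and g: "square_integrable lebesgue g"
  obtains r where "strict_mono r" "L2_conv lebesgue (\<lambda>n x. soft c (p (r n) x)) (\<lambda>x. soft c (f x))"
    "L2_conv lebesgue (\<lambda>n. grad (\<lambda>x. soft c (p (r n) x))) (\<lambda>x. soft' c (f x) *\<^sub>R g x)"
proof -
  note [measurable] = L2_convD[OF p(2)] borel_measurable_continuous_onI[OF continuous_soft[OF c]]
  obtain r where r: "strict_mono r" "AE x in lebesgue. (\<lambda>n. p (r n) x) \<longlonglongrightarrow> f x"
    using L2_conv_AE_subseq[OF p(2)] by blast
  show ?thesis
  proof (rule that[OF r(1)])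
    show "L2_conv lebesgue (\<lambda>n x. soft c (p (r n) x)) (\<lambda>x. soft c (f x))"
      by (rule L2_conv_null[OF L2_conv_subseq[OF p(2) r(1)]])
         (auto simp: soft_lipschitz[OF c])
    have "L2_conv lebesgue (\<lambda>n x. soft' c (p (r n) x) *\<^sub>R grad (p (r n)) x) (\<lambda>x. soft' c (f x) *\<^sub>R g x)"
      by (rule L2_conv_scaleR_bounded[OF L2_conv_subseq[OF p(3) r(1)] g _ _ r(2) continuous_soft'[OF c]])
         (use soft'_bounds[OF c] in \<open>auto simp: abs_le_iff intro: order_trans[of _ 0]\<close>)
    moreover have "grad (\<lambda>x. soft c (p (r n) x)) = (\<lambda>x. soft' c (p (r n) x) *\<^sub>R grad (p (r n)) x)" for n
      using grad_soft[OF c p(1)] by blast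
    ultimately show "L2_conv lebesgue (\<lambda>n. grad (\<lambda>x. soft c (p (r n) x))) (\<lambda>x. soft' c (f x) *\<^sub>R g x)"
      by simp
  qed
qed

lemma grad_uminus_fun: "smooth f \<Longrightarrow> grad (\<lambda>x. - f x) = (\<lambda>x. - grad f x)"
  using grad_uminus by blast

text \<open>Since \<open>soft c\<close> vanishes on non-positive arguments, a compact set that
  carries \<psi> also carries the composite.\<close>

lemma soft_test_function:
  assumes c: "c > 0" and \<psi>: "\<psi> \<in> test_functions U" and p: "smooth p" "\<And>x. \<psi> x = 0 \<Longrightarrow> p x \<le> 0"
  shows "(\<lambda>x. soft c (p x)) \<in> test_functions U"
proof -
  obtain K where "compact K" "K \<subseteq> U" "\<And>x. x \<notin> K \<Longrightarrow> \<psi> x = 0"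
    using \<psi> unfolding test_functions_iff by blast
  then show ?thesis
    unfolding test_functions_iff using smooth_soft[OF c p(1)] soft_nonpos p(2) by blast
qed

text \<open>The equation is tested with \<open>soft 1\<close> of -f, a smooth negative part. The
  gradient side is then at most 0 and the exponential side at least 0, so the non-negative integrand
  on the latter vanishes almost everywhere.\<close>

lemma H10_solution_nonneg:
  assumes c: "c > 0" and sol: "H10_solution U c f g"
  shows "AE x in lebesgue. f x \<ge> 0"
proof -
  have lim: "H10_limit U f g" using sol by (simp add: H10_solution_def)
  obtain \<psi> where \<psi>: "\<And>n. \<psi> n \<in> test_functions U" "L2_conv lebesgue \<psi> f"
    "L2_conv lebesgue (\<lambda>n. grad (\<psi> n)) g"
    using lim unfolding H10_limit_def by blast
  have sm: "smooth (\<psi> n)" for n using \<psi>(1)[of n] by (simp add: test_functions_iff)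
  note sq = H10_limit_square_integrable[OF lim]
  obtain r where r: "L2_conv lebesgue (\<lambda>n x. soft 1 (- \<psi> (r n) x)) (\<lambda>x. soft 1 (- f x))"
    "L2_conv lebesgue (\<lambda>n. grad (\<lambda>x. soft 1 (- \<psi> (r n) x))) (\<lambda>x. soft' 1 (- f x) *\<^sub>R - g x)"
    by (rule L2_conv_soft[of 1 "\<lambda>n x. - \<psi> n x" "\<lambda>x. - f x" "\<lambda>x. - g x"])
       (use sm \<psi> sq in \<open>auto intro!: smooth_uminus L2_conv_uminus square_integrable_uminus
         simp: grad_uminus_fun\<close>)
  have t: "(\<lambda>x. soft 1 (- \<psi> n x)) \<in> test_functions U" for n
    by (rule soft_test_function[OF _ \<psi>(1)[of n]]) (auto intro: smooth_uminus sm)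
  have "H10_limit U (\<lambda>x. soft 1 (- f x)) (\<lambda>x. soft' 1 (- f x) *\<^sub>R - g x)"
    unfolding H10_limit_def using r t by (intro exI[of _ "\<lambda>n x. soft 1 (- \<psi> (r n) x)"]) auto
  then have int: "integrable lebesgue (\<lambda>x. exp (- f x) * soft 1 (- f x))"
    and eq: "(\<integral>x. g x \<bullet> (soft' 1 (- f x) *\<^sub>R - g x) \<partial>lebesgue) = c * (\<integral>x. exp (- f x) * soft 1 (- f x) \<partial>lebesgue)"
    using sol unfolding H10_solution_def by blast+
  have "(\<integral>x. g x \<bullet> (soft' 1 (- f x) *\<^sub>R - g x) \<partial>lebesgue) = - (\<integral>x. soft' 1 (- f x) * (g x \<bullet> g x) \<partial>lebesgue)"
    by simp
  also have "\<dots> \<le> 0"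
    by (simp add: soft'_bounds)
  finally have "c * (\<integral>x. exp (- f x) * soft 1 (- f x) \<partial>lebesgue) \<le> 0" unfolding eq .
  then have "(\<integral>x. exp (- f x) * soft 1 (- f x) \<partial>lebesgue) \<le> 0"
    using c by (simp add: mult_le_0_iff)
  moreover have "(\<integral>x. exp (- f x) * soft 1 (- f x) \<partial>lebesgue) \<ge> 0"
    by (simp add: soft_nonneg)
  ultimately have "AE x in lebesgue. exp (- f x) * soft 1 (- f x) = 0"
    using integral_nonneg_eq_0_iff_AE[OF int] by (simp add: soft_nonneg)
  then show ?thesis
    by eventually_elim (metis exp_not_eq_zero less_irrefl mult_eq_0_iff neg_0_less_iff_less not_le soft_pos)
qed

text \<open>The truncation \<open>soft d (- f\<^sub>2)\<close> vanishes in the limit because \<open>f\<^sub>2 \<ge> 0\<close>, but it keeps the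
  approximations of \<open>f\<^sub>2 + d\<close> non-negative, so that the composite vanishes where those of \<open>f\<^sub>1\<close> do.\<close>

lemma H10_limit_soft_diff:
  assumes d: "d > 0" and lim: "H10_limit U f1 g1" "H10_limit V f2 g2"
    and nonneg: "AE x in lebesgue. f2 x \<ge> 0"
  shows "H10_limit U (\<lambda>x. soft 1 (f1 x - f2 x - d)) (\<lambda>x. soft' 1 (f1 x - f2 x - d) *\<^sub>R (g1 x - g2 x))"
proof -
  obtain \<psi> where \<psi>: "\<And>n. \<psi> n \<in> test_functions U" "L2_conv lebesgue \<psi> f1" "L2_conv lebesgue (\<lambda>n. grad (\<psi> n)) g1"
    using lim(1) unfolding H10_limit_def by blast
  obtain \<eta> where \<eta>: "\<And>n. \<eta> n \<in> test_functions V" "L2_conv lebesgue \<eta> f2" "L2_conv lebesgue (\<lambda>n. grad (\<eta> n)) g2"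
    using lim(2) unfolding H10_limit_def by blast
  note sq = H10_limit_square_integrable[OF lim(1)] H10_limit_square_integrable[OF lim(2)]
  note [measurable] = sq[THEN square_integrable_measurable]
  note [measurable] = borel_measurable_continuous_onI[OF continuous_soft[of 1]]
    borel_measurable_continuous_onI[OF continuous_soft'[of 1]]
  have sm: "smooth (\<psi> n)" "smooth (\<eta> n)" for n
    using \<psi>(1)[of n] \<eta>(1)[of n] by (simp_all add: test_functions_iff)
  obtain r where r: "strict_mono r" "L2_conv lebesgue (\<lambda>n x. soft d (- \<eta> (r n) x)) (\<lambda>x. soft d (- f2 x))"
    "L2_conv lebesgue (\<lambda>n. grad (\<lambda>x. soft d (- \<eta> (r n) x))) (\<lambda>x. soft' d (- f2 x) *\<^sub>R - g2 x)"
    by (rule L2_conv_soft[of d "\<lambda>n x. - \<eta> n x" "\<lambda>x. - f2 x" "\<lambda>x. - g2 x"])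
       (use d sm \<eta> sq in \<open>auto intro!: smooth_uminus L2_conv_uminus square_integrable_uminus
         simp: grad_uminus_fun\<close>)
  have zero: "AE x in lebesgue. soft d (- f2 x) = 0" "AE x in lebesgue. soft' d (- f2 x) *\<^sub>R - g2 x = 0"
    using nonneg by (eventually_elim; simp add: soft_nonpos soft'_nonpos)+
  have conv0: "L2_conv lebesgue (\<lambda>n x. soft d (- \<eta> (r n) x)) (\<lambda>x. 0)"
    "L2_conv lebesgue (\<lambda>n. grad (\<lambda>x. soft d (- \<eta> (r n) x))) (\<lambda>x. 0)"
    using L2_conv_cong_AE[OF r(2) zero(1)] L2_conv_cong_AE[OF r(3) zero(2)] by simp_all
  define p where "p n x = \<psi> (r n) x - \<eta> (r n) x - d - soft d (- \<eta> (r n) x)" for n x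
  have sp: "smooth (p n)" for n
    unfolding p_def[abs_def] using d
    by (intro smooth_diff smooth_const smooth_soft smooth_uminus sm)
  have gp: "grad (p n) = (\<lambda>x. grad (\<psi> (r n)) x - grad (\<eta> (r n)) x - 0 - grad (\<lambda>x. soft d (- \<eta> (r n) x)) x)" for n
  proof
    fix x :: 'a
    have "grad (\<lambda>x. d) x = 0" by (rule gradI) simp
    then show "grad (p n) x = grad (\<psi> (r n)) x - grad (\<eta> (r n)) x - 0 - grad (\<lambda>x. soft d (- \<eta> (r n) x)) x"
      unfolding p_def[abs_def] using d
      by (simp add: grad_diff smooth_diff smooth_const smooth_soft smooth_uminus sm)
  qed
  \<comment> \<open>The constant d is not square integrable over the whole space, but it cancels in
    the error.\<close>
  have "L2_conv lebesgue p (\<lambda>x. f1 x - f2 x - d - 0)"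
    unfolding p_def[abs_def]
    by (intro L2_conv_diff L2_conv_subseq[OF \<psi>(2) r(1)] L2_conv_subseq[OF \<eta>(2) r(1)] L2_conv_const conv0) simp
  moreover have "L2_conv lebesgue (\<lambda>n. grad (p n)) (\<lambda>x. g1 x - g2 x - 0 - 0)"
    unfolding gp
    by (intro L2_conv_diff L2_conv_subseq[OF \<psi>(3) r(1)] L2_conv_subseq[OF \<eta>(3) r(1)] L2_conv_const conv0) simp
  ultimately obtain r' where r': "strict_mono r'"
    "L2_conv lebesgue (\<lambda>n x. soft 1 (p (r' n) x)) (\<lambda>x. soft 1 (f1 x - f2 x - d))"
    "L2_conv lebesgue (\<lambda>n. grad (\<lambda>x. soft 1 (p (r' n) x))) (\<lambda>x. soft' 1 (f1 x - f2 x - d) *\<^sub>R (g1 x - g2 x))"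
    using L2_conv_soft[of 1 p "\<lambda>x. f1 x - f2 x - d" "\<lambda>x. g1 x - g2 x", OF _ sp] square_integrable_diff[OF sq(2,4)]
    by auto
  have "(\<lambda>x. soft 1 (p n x)) \<in> test_functions U" for n
  proof (rule soft_test_function[OF _ \<psi>(1)[of "r n"] sp])
    fix x assume "\<psi> (r n) x = 0"
    then show "p n x \<le> 0"
      using soft_ge[OF d, of "- \<eta> (r n) x"] by (simp add: p_def)
  qed simp
  then show ?thesis
    unfolding H10_limit_def using r' by (intro exI[of _ "\<lambda>n x. soft 1 (p (r' n) x)"]) auto
qed

text \<open>The test function v = \<open>soft 1 (f1 x - f2 x - d)\<close> is admissible for U and
  hence for V. Subtracting the two equations gives the integral of \<open>soft'\<close> times |g1 -
  g2|^2, which is non-negative, on one side and c times the integral of (exp (- f1) - exp (- f2)) v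
  on the other. The latter integrand is negative wherever v > 0, so v vanishes almost
  everywhere.\<close>

lemma H10_solution_le:
  assumes c: "c > 0" and sub: "U \<subseteq> V" and sol: "H10_solution U c f1 g1" "H10_solution V c f2 g2"
  shows "AE x in lebesgue. f1 x \<le> f2 x"
proof -
  have lim: "H10_limit U f1 g1" "H10_limit V f2 g2" using sol by (simp_all add: H10_solution_def)
  note sq = H10_limit_square_integrable[OF lim(1)] H10_limit_square_integrable[OF lim(2)]
  have le: "AE x in lebesgue. f1 x \<le> f2 x + d" if d: "d > 0" for d
  proof -
    define v where "v x = soft 1 (f1 x - f2 x - d)" for x
    define h where "h x = soft' 1 (f1 x - f2 x - d) *\<^sub>R (g1 x - g2 x)" for x
    have vh: "H10_limit U v h"
      unfolding v_def[abs_def] h_def[abs_def]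
      by (rule H10_limit_soft_diff[OF d lim H10_solution_nonneg[OF c sol(2)]])
    have 1: "integrable lebesgue (\<lambda>x. exp (- f1 x) * v x)"
      "(\<integral>x. g1 x \<bullet> h x \<partial>lebesgue) = c * (\<integral>x. exp (- f1 x) * v x \<partial>lebesgue)"
      using sol(1) vh unfolding H10_solution_def by blast+
    have 2: "integrable lebesgue (\<lambda>x. exp (- f2 x) * v x)"
      "(\<integral>x. g2 x \<bullet> h x \<partial>lebesgue) = c * (\<integral>x. exp (- f2 x) * v x \<partial>lebesgue)"
      using sol(2) H10_limit_mono[OF sub vh] unfolding H10_solution_def by blast+
    have hs: "square_integrable lebesgue h" by (rule H10_limit_square_integrable[OF vh])
    have "0 \<le> (\<integral>x. soft' 1 (f1 x - f2 x - d) * ((g1 x - g2 x) \<bullet> (g1 x - g2 x)) \<partial>lebesgue)"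
      by (simp add: soft'_bounds)
    also have "\<dots> = (\<integral>x. g1 x \<bullet> h x - g2 x \<bullet> h x \<partial>lebesgue)"
      by (simp add: h_def inner_diff_left right_diff_distrib)
    also have "\<dots> = (\<integral>x. g1 x \<bullet> h x \<partial>lebesgue) - (\<integral>x. g2 x \<bullet> h x \<partial>lebesgue)"
      by (intro Bochner_Integration.integral_diff integrable_inner_square_integrable sq hs)
    also have "\<dots> = - (c * (\<integral>x. exp (- f2 x) * v x - exp (- f1 x) * v x \<partial>lebesgue))"
      using 1 2 by (simp add: algebra_simps)
    finally have "(\<integral>x. exp (- f2 x) * v x - exp (- f1 x) * v x \<partial>lebesgue) \<le> 0"
      using c by (simp add: mult_le_0_iff)
    moreover have nonneg: "0 \<le> exp (- f2 x) * v x - exp (- f1 x) * v x" for x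
    proof (cases "f1 x - f2 x - d \<le> 0")
      case False
      then have "exp (- f1 x) \<le> exp (- f2 x)" using d by simp
      then show ?thesis using mult_right_mono[OF _ soft_nonneg] by (simp add: v_def)
    qed (simp add: v_def soft_nonpos)
    moreover have "(\<integral>x. exp (- f2 x) * v x - exp (- f1 x) * v x \<partial>lebesgue) \<ge> 0"
      using nonneg by simp
    ultimately have "AE x in lebesgue. exp (- f2 x) * v x - exp (- f1 x) * v x = 0"
      using integral_nonneg_eq_0_iff_AE[of lebesgue "\<lambda>x. exp (- f2 x) * v x - exp (- f1 x) * v x"] 1 2
      by simp
    then show ?thesis
    proof eventually_elim
      case (elim x)
      show ?case
      proof (rule ccontr)
        assume "\<not> f1 x \<le> f2 x + d"
        then have "v x > 0" "exp (- f1 x) < exp (- f2 x)" using d by (auto simp: v_def intro: soft_pos)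
        then show False using elim by (simp flip: left_diff_distrib)
      qed
    qed
  qed
  \<comment> \<open>Only countably many shifts are used, so that their exceptional null sets can be
    united before passing to the limit.\<close>
  have "AE x in lebesgue. \<forall>n::nat. f1 x \<le> f2 x + 1 / real (Suc n)"
    unfolding AE_all_countable using le by simp
  then show ?thesis
  proof eventually_elim
    case (elim x)
    have "(\<lambda>n. f2 x + 1 / real (Suc n)) \<longlonglongrightarrow> f2 x + 0"
      by (intro tendsto_intros LIMSEQ_Suc[OF lim_1_over_n])
    then show ?case
      using LIMSEQ_le_const[of "\<lambda>n. f2 x + 1 / real (Suc n)" "f2 x" "f1 x"] elim by auto
  qed
qed

text \<open>Continuity makes the set of violations open, the comparison makes it null, and a
  non-empty open set is not null.\<close>

lemma H10_solution_le_pointwise: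
  assumes U: "open U" "open V" "U \<subseteq> V" and c: "c > 0"
    and sol: "H10_solution U c (zero_extension U f1) g1" "H10_solution V c (zero_extension V f2) g2"
    and cont: "continuous_on U f1" "continuous_on V f2" and x: "x \<in> U"
  shows "f1 x \<le> f2 x"
proof (rule ccontr)
  let ?N = "{x \<in> U. f2 x < f1 x}"
  assume "\<not> f1 x \<le> f2 x"
  then have "?N \<noteq> {}" using x by auto
  moreover have "open ?N"
  proof -
    have "continuous_on U (\<lambda>x. f1 x - f2 x)"
      using cont U(3) by (intro continuous_intros) (auto intro: continuous_on_subset)
    from continuous_open_preimage[OF this U(1), of "{0<..}"] show ?thesis
      by (simp add: vimage_def Int_def)
  qed
  moreover have "negligible ?N"
  proof -
    have "AE x in lebesgue. x \<notin> ?N"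
      using H10_solution_le[OF c U(3) sol]
      by eventually_elim (use U(3) in \<open>auto simp: zero_extension_def subset_iff split: if_splits\<close>)
    moreover have "?N \<in> sets lebesgue" using \<open>open ?N\<close> by simp
    ultimately show ?thesis by (simp add: negligible_iff_null_sets AE_iff_null_sets)
  qed
  ultimately show False using open_not_negligible by blast
qed

subsection \<open>Dilations\<close>

lemma lebesgue_scaleR:
  assumes "s > 0"
  shows "(lebesgue :: 'a::euclidean_space measure) =
    density (distr lebesgue lebesgue ((*\<^sub>R) s)) (\<lambda>_. ennreal (s ^ DIM('a)))"
proof -
  have "(\<lambda>x::'a. 0 + (\<Sum>j\<in>Basis. (s * (x \<bullet> j)) *\<^sub>R j)) = (*\<^sub>R) s"
    by (auto simp: euclidean_representation fun_eq_iff simp flip: scaleR_scaleR scaleR_sum_right)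
  then show ?thesis
    using lebesgue_affine_euclidean[of "\<lambda>_. s" "0::'a"] assms by simp
qed

lemma measurable_lebesgue_scaleR:
  "f \<in> borel_measurable lebesgue \<Longrightarrow> (\<lambda>x. f (s *\<^sub>R x)) \<in> borel_measurable lebesgue"
  using measurable_compose[OF lebesgue_measurable_scaling] by blast

lemma nn_integral_lebesgue_scaleR:
  fixes f :: "'a::euclidean_space \<Rightarrow> ennreal"
  assumes s: "s > 0" and f: "f \<in> borel_measurable lebesgue"
  shows "(\<integral>\<^sup>+x. f x \<partial>lebesgue) = ennreal (s ^ DIM('a)) * (\<integral>\<^sup>+x. f (s *\<^sub>R x) \<partial>lebesgue)"
proof -
  have "(\<integral>\<^sup>+x. f x \<partial>lebesgue) = (\<integral>\<^sup>+x. f x \<partial>density (distr lebesgue lebesgue ((*\<^sub>R) s)) (\<lambda>_. ennreal (s ^ DIM('a))))"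
    using lebesgue_scaleR[OF s, where 'a='a] by simp
  also have "\<dots> = ennreal (s ^ DIM('a)) * (\<integral>\<^sup>+x. f x \<partial>distr lebesgue lebesgue ((*\<^sub>R) s))"
    using f by (subst nn_integral_density) (auto simp: nn_integral_cmult)
  also have "(\<integral>\<^sup>+x. f x \<partial>distr lebesgue lebesgue ((*\<^sub>R) s)) = (\<integral>\<^sup>+x. f (s *\<^sub>R x) \<partial>lebesgue)"
    using f by (subst nn_integral_distr) auto
  finally show ?thesis .
qed

lemma integral_lebesgue_scaleR:
  fixes f :: "'a::euclidean_space \<Rightarrow> real"
  assumes s: "s > 0" and f: "f \<in> borel_measurable lebesgue"
  shows "integrable lebesgue f \<longleftrightarrow> integrable lebesgue (\<lambda>x. f (s *\<^sub>R x))"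
    "(\<integral>x. f x \<partial>lebesgue) = s ^ DIM('a) * (\<integral>x. f (s *\<^sub>R x) \<partial>lebesgue)"
proof -
  let ?D = "distr lebesgue lebesgue ((*\<^sub>R) s) :: 'a measure"
  have f': "f \<in> borel_measurable ?D" using f by simp
  have "integrable lebesgue f \<longleftrightarrow> integrable (density ?D (\<lambda>_. ennreal (s ^ DIM('a)))) f"
    using lebesgue_scaleR[OF s, where 'a='a] by simp
  also have "\<dots> \<longleftrightarrow> integrable ?D f"
    using f' s by (subst integrable_density) auto
  also have "\<dots> \<longleftrightarrow> integrable lebesgue (\<lambda>x. f (s *\<^sub>R x))"
    by (rule integrable_distr_eq) (use f in auto)
  finally show "integrable lebesgue f \<longleftrightarrow> integrable lebesgue (\<lambda>x. f (s *\<^sub>R x))" .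
  have "(\<integral>x. f x \<partial>lebesgue) = (\<integral>x. f x \<partial>density ?D (\<lambda>_. ennreal (s ^ DIM('a))))"
    using lebesgue_scaleR[OF s, where 'a='a] by simp
  also have "\<dots> = s ^ DIM('a) * (\<integral>x. f x \<partial>?D)"
    using f' s by (subst integral_density) auto
  also have "(\<integral>x. f x \<partial>?D) = (\<integral>x. f (s *\<^sub>R x) \<partial>lebesgue)"
    by (rule integral_distr) (use f in auto)
  finally show "(\<integral>x. f x \<partial>lebesgue) = s ^ DIM('a) * (\<integral>x. f (s *\<^sub>R x) \<partial>lebesgue)" .
qed

lemma L2_conv_scaleR_arg:
  fixes f :: "'a::euclidean_space \<Rightarrow> 'b::euclidean_space"
  assumes s: "s > 0" and conv: "L2_conv lebesgue u f"
  shows "L2_conv lebesgue (\<lambda>n x. u n (s *\<^sub>R x)) (\<lambda>x. f (s *\<^sub>R x))"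
proof -
  note [measurable] = L2_convD[OF conv]
  define A where "A n = (\<integral>\<^sup>+x. ennreal ((norm (u n x - f x))\<^sup>2) \<partial>lebesgue)" for n
  have "(\<integral>\<^sup>+x. ennreal ((norm (u n (s *\<^sub>R x) - f (s *\<^sub>R x)))\<^sup>2) \<partial>lebesgue) = ennreal ((1 / s) ^ DIM('a)) * A n" for n
    unfolding A_def
    using nn_integral_lebesgue_scaleR[of "1 / s" "\<lambda>x. ennreal ((norm (u n (s *\<^sub>R x) - f (s *\<^sub>R x)))\<^sup>2)"]
      measurable_lebesgue_scaleR[of "\<lambda>x. ennreal ((norm (u n x - f x))\<^sup>2)" s] s by simp
  moreover have "(\<lambda>n. ennreal ((1 / s) ^ DIM('a)) * A n) \<longlonglongrightarrow> ennreal ((1 / s) ^ DIM('a)) * 0"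
    using conv by (intro ennreal_tendsto_cmult) (simp_all add: A_def[abs_def] L2_conv_def)
  ultimately show ?thesis
    unfolding L2_conv_def using L2_convD[OF conv] measurable_lebesgue_scaleR by simp
qed

lemma L2_conv_cmult_scaleR:
  assumes conv: "L2_conv M u f"
  shows "L2_conv M (\<lambda>n x. c *\<^sub>R u n x) (\<lambda>x. c *\<^sub>R f x)"
proof -
  note [measurable] = L2_convD[OF conv]
  have "(\<integral>\<^sup>+x. ennreal ((norm (c *\<^sub>R u n x - c *\<^sub>R f x))\<^sup>2) \<partial>M) =
      ennreal (c\<^sup>2) * (\<integral>\<^sup>+x. ennreal ((norm (u n x - f x))\<^sup>2) \<partial>M)" for n
    by (simp add: ennreal_mult power_mult_distrib nn_integral_cmult flip: scaleR_diff_right)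
  moreover have "(\<lambda>n. ennreal (c\<^sup>2) * (\<integral>\<^sup>+x. ennreal ((norm (u n x - f x))\<^sup>2) \<partial>M)) \<longlonglongrightarrow> ennreal (c\<^sup>2) * 0"
    using conv by (intro ennreal_tendsto_cmult) (simp_all add: L2_conv_def)
  ultimately show ?thesis unfolding L2_conv_def by simp
qed

lemma test_function_scaleR:
  assumes s: "s > 0" and \<psi>: "\<psi> \<in> test_functions U"
  shows "(\<lambda>x. \<psi> (s *\<^sub>R x)) \<in> test_functions {x. s *\<^sub>R x \<in> U}"
proof -
  obtain K where K: "compact K" "K \<subseteq> U" "\<And>x. x \<notin> K \<Longrightarrow> \<psi> x = 0"
    using \<psi> unfolding test_functions_iff by blast
  have "\<psi> (s *\<^sub>R x) = 0" if "x \<notin> (*\<^sub>R) (1 / s) ` K" for x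
  proof (rule K(3), rule)
    assume "s *\<^sub>R x \<in> K"
    then have "(1 / s) *\<^sub>R (s *\<^sub>R x) \<in> (*\<^sub>R) (1 / s) ` K" by (rule imageI)
    with that s show False by simp
  qed
  moreover have "compact ((*\<^sub>R) (1 / s) ` K)" using K(1) by (rule compact_scaling)
  moreover have "(*\<^sub>R) (1 / s) ` K \<subseteq> {x. s *\<^sub>R x \<in> U}" using K(2) s by auto
  ultimately show ?thesis
    using \<psi> smooth_scaleR unfolding test_functions_iff by blast
qed

lemma H10_limit_scaleR:
  assumes s: "s > 0" and lim: "H10_limit U f g"
  shows "H10_limit {x. s *\<^sub>R x \<in> U} (\<lambda>x. f (s *\<^sub>R x)) (\<lambda>x. s *\<^sub>R g (s *\<^sub>R x))"
proof -
  obtain \<psi> where \<psi>: "\<And>n. \<psi> n \<in> test_functions U" "L2_conv lebesgue \<psi> f" "L2_conv lebesgue (\<lambda>n. grad (\<psi> n)) g"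
    using lim unfolding H10_limit_def by blast
  have g: "grad (\<lambda>x. \<psi> n (s *\<^sub>R x)) = (\<lambda>x. s *\<^sub>R grad (\<psi> n) (s *\<^sub>R x))" for n
    using \<psi>(1)[of n] grad_scaleR[of "\<psi> n" s] by (auto simp: test_functions_iff)
  show ?thesis
    unfolding H10_limit_def
  proof (intro exI[of _ "\<lambda>n x. \<psi> n (s *\<^sub>R x)"] conjI allI)
    show "L2_conv lebesgue (\<lambda>n. grad (\<lambda>x. \<psi> n (s *\<^sub>R x))) (\<lambda>x. s *\<^sub>R g (s *\<^sub>R x))"
      unfolding g by (rule L2_conv_cmult_scaleR[OF L2_conv_scaleR_arg[OF s \<psi>(3)]])
  qed (use test_function_scaleR[OF s \<psi>(1)] L2_conv_scaleR_arg[OF s \<psi>(2)] in auto)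
qed

text \<open>The volume factors cancel. Each of the two gradients contributes one factor s, whence c
  * s^2; this turns the coefficient 1 / \<epsilon>^2 into 1 when s = \<epsilon>.\<close>

lemma H10_solution_scaleR:
  fixes U :: "'a::euclidean_space set"
  assumes s: "s > 0" and sol: "H10_solution U c f g"
  shows "H10_solution {x. s *\<^sub>R x \<in> U} (c * s\<^sup>2) (\<lambda>x. f (s *\<^sub>R x)) (\<lambda>x. s *\<^sub>R g (s *\<^sub>R x))"
  unfolding H10_solution_def
proof (intro conjI allI impI)
  have lim: "H10_limit U f g" using sol by (simp add: H10_solution_def)
  show "H10_limit {x. s *\<^sub>R x \<in> U} (\<lambda>x. f (s *\<^sub>R x)) (\<lambda>x. s *\<^sub>R g (s *\<^sub>R x))"
    by (rule H10_limit_scaleR[OF s lim])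
  fix v h assume vh: "H10_limit {x. s *\<^sub>R x \<in> U} v h"
  \<comment> \<open>The test pair is dilated back to U; the factor 1 / s in \<open>k\<close> comes
    from the chain rule.\<close>
  define w where "w x = v ((1 / s) *\<^sub>R x)" for x
  define k where "k x = (1 / s) *\<^sub>R h ((1 / s) *\<^sub>R x)" for x
  have "H10_limit {x. (1 / s) *\<^sub>R x \<in> {x. s *\<^sub>R x \<in> U}} w k"
    unfolding w_def[abs_def] k_def[abs_def] using s by (intro H10_limit_scaleR vh) simp
  moreover have "{x. (1 / s) *\<^sub>R x \<in> {x. s *\<^sub>R x \<in> U}} = U" using s by simp
  ultimately have wk: "H10_limit U w k" by simp
  have int: "integrable lebesgue (\<lambda>x. exp (- f x) * w x)"
    and eq: "(\<integral>x. g x \<bullet> k x \<partial>lebesgue) = c * (\<integral>x. exp (- f x) * w x \<partial>lebesgue)"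
    using sol wk unfolding H10_solution_def by blast+
  note [measurable] = H10_limit_square_integrable[OF lim, THEN square_integrable_measurable]
    H10_limit_square_integrable[OF wk, THEN square_integrable_measurable]
  have wv: "w (s *\<^sub>R x) = v x" and kh: "k (s *\<^sub>R x) = (1 / s) *\<^sub>R h x" for x
    using s by (simp_all add: w_def k_def)
  show "integrable lebesgue (\<lambda>x. exp (- f (s *\<^sub>R x)) * v x)"
    using int integral_lebesgue_scaleR(1)[OF s, of "\<lambda>x. exp (- f x) * w x"] by (simp add: wv)
  have 1: "(\<integral>x. exp (- f x) * w x \<partial>lebesgue) = s ^ DIM('a) * (\<integral>x. exp (- f (s *\<^sub>R x)) * v x \<partial>lebesgue)"
    using integral_lebesgue_scaleR(2)[OF s, of "\<lambda>x. exp (- f x) * w x"] by (simp add: wv)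
  have 2: "(\<integral>x. g x \<bullet> k x \<partial>lebesgue) = s ^ DIM('a) * ((1 / s) * (\<integral>x. g (s *\<^sub>R x) \<bullet> h x \<partial>lebesgue))"
    using integral_lebesgue_scaleR(2)[OF s, of "\<lambda>x. g x \<bullet> k x"] by (simp add: kh)
  have "(\<integral>x. g (s *\<^sub>R x) \<bullet> h x \<partial>lebesgue) = c * s * (\<integral>x. exp (- f (s *\<^sub>R x)) * v x \<partial>lebesgue)"
    using eq s unfolding 1 2 by (simp add: field_simps)
  then show "(\<integral>x. (s *\<^sub>R g (s *\<^sub>R x)) \<bullet> h x \<partial>lebesgue) = c * s\<^sup>2 * (\<integral>x. exp (- f (s *\<^sub>R x)) * v x \<partial>lebesgue)"
    by (simp add: power2_eq_square)
qed

subsection \<open>The corner\<close>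

lemma sector_scaleR:
  assumes "x \<in> sector \<theta>" "s > 0"
  shows "s *\<^sub>R x \<in> sector \<theta>"
proof -
  from assms(1) obtain r t where "x = vector [r * cos t, r * sin t]" "0 < r" "\<bar>t\<bar> < \<theta>"
    unfolding sector_def by blast
  moreover from this have "s *\<^sub>R x = vector [(s * r) * cos t, (s * r) * sin t]"
    by (simp add: vec_eq_iff forall_2)
  moreover have "0 < s * r" using assms(2) \<open>0 < r\<close> by simp
  ultimately show ?thesis unfolding sector_def by blast
qed

lemma model_cones_scaleR: "K \<in> model_cones \<Longrightarrow> x \<in> K \<Longrightarrow> s > 0 \<Longrightarrow> s *\<^sub>R x \<in> K"
  unfolding model_cones_def using sector_scaleR by auto

text \<open>A point of the cone is shrunk into W, where a ball fits, and the inverse dilation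
  carries this ball back. Openness of sectors thus follows from the chart, without polar
  coordinates.\<close>

lemma open_cone_of_open_near_0:
  fixes K W :: "'a::real_normed_vector set"
  assumes cone: "\<And>x s. x \<in> K \<Longrightarrow> s > 0 \<Longrightarrow> s *\<^sub>R x \<in> K"
    and W: "open W" "0 \<in> W" and KW: "open (K \<inter> W)"
  shows "open K"
  unfolding open_contains_ball
proof
  fix x assume x: "x \<in> K"
  have "((\<lambda>s. s *\<^sub>R x) \<longlongrightarrow> 0 *\<^sub>R x) (at_right 0)" by (intro tendsto_intros)
  then have "\<forall>\<^sub>F s in at_right 0. s *\<^sub>R x \<in> W" using W by (intro topological_tendstoD) auto
  then have "\<forall>\<^sub>F s in at_right 0. s *\<^sub>R x \<in> W \<and> (0::real) < s"
    using eventually_at_right_less by (rule eventually_conj)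
  then obtain s :: real where s: "s > 0" "s *\<^sub>R x \<in> W"
    using eventually_happens'[of "at_right (0::real)"] by (auto simp: trivial_limit_at_right_real)
  then obtain e where e: "e > 0" "ball (s *\<^sub>R x) e \<subseteq> K \<inter> W"
    using KW cone[OF x] by (meson IntI open_contains_ball)
  have "ball x (e / s) \<subseteq> K"
  proof
    fix y assume "y \<in> ball x (e / s)"
    then have "s * dist x y < e" using s(1) by (simp add: field_simps)
    then have "s *\<^sub>R y \<in> ball (s *\<^sub>R x) e"
      using s(1) by (simp add: dist_norm flip: scaleR_diff_right)
    then have "s *\<^sub>R y \<in> K" using e(2) by blast
    from cone[OF this, of "1 / s"] show "y \<in> K" using s(1) by simp
  qed
  then show "\<exists>e>0. ball x e \<subseteq> K" using e(1) s(1) by (intro exI[of _ "e / s"]) simp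
qed

text \<open>Near the apex the model cone \<open>K\<close> is the image of an open set under the
  chart, hence open, and T is its preimage under the derivative \<open>D\<close> at 0. For w in T
  the quotients \<Psi> (t w) / t tend to \<open>D w\<close> in \<open>K\<close>, so \<Psi> (t w)
  lies in \<open>K\<close> for small t, and injectivity of \<Psi> puts t w in U. How small t must be
  depends on w.\<close>

lemma has_tangent_coneD:
  assumes U: "open U" and T: "has_tangent_cone U 0 T"
  shows "open T" "w \<in> T \<Longrightarrow> \<forall>\<^sub>F \<epsilon> in at_right 0. \<epsilon> *\<^sub>R w \<in> U"
proof -
  from T obtain \<eta> K \<Psi> W where \<eta>: "\<eta> > 0" and K: "K \<in> model_cones"
    and diff: "C2_diffeo (ball 0 \<eta>) W \<Psi>" and 0: "\<Psi> 0 = 0" and img: "\<Psi> ` (U \<inter> ball 0 \<eta>) = K \<inter> W"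
    and T_eq: "T = {w. frechet_derivative \<Psi> (at 0) w \<in> K}"
    unfolding has_tangent_cone_def local_chart_def by blast
  let ?inv = "inv_into (ball 0 \<eta>) \<Psi>"
  have W: "open W" and bij: "bij_betw \<Psi> (ball 0 \<eta>) W" and C2: "Ck_on 2 (ball 0 \<eta>) \<Psi>" "Ck_on 2 W ?inv"
    using diff by (auto simp: C2_diffeo_def)
  have dinv: "\<And>x. x \<in> W \<Longrightarrow> ?inv differentiable at x"
    and d\<Psi>: "\<Psi> differentiable at 0"
    using C2 \<eta> by (auto simp: numeral_2_eq_2)
  have "open (K \<inter> W)"
  proof -
    have "continuous_on W ?inv"
      using dinv by (meson continuous_at_imp_continuous_on differentiable_imp_continuous_within)
    then have "open (W \<inter> ?inv -` (U \<inter> ball 0 \<eta>))"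
      using W U by (intro continuous_open_preimage) auto
    also have "W \<inter> ?inv -` (U \<inter> ball 0 \<eta>) = \<Psi> ` (U \<inter> ball 0 \<eta>)"
    proof
      show "W \<inter> ?inv -` (U \<inter> ball 0 \<eta>) \<subseteq> \<Psi> ` (U \<inter> ball 0 \<eta>)"
      proof
        fix y assume y: "y \<in> W \<inter> ?inv -` (U \<inter> ball 0 \<eta>)"
        then have "y = \<Psi> (?inv y)" using bij_betw_inv_into_right[OF bij] by simp
        then show "y \<in> \<Psi> ` (U \<inter> ball 0 \<eta>)" using y by blast
      qed
      show "\<Psi> ` (U \<inter> ball 0 \<eta>) \<subseteq> W \<inter> ?inv -` (U \<inter> ball 0 \<eta>)"
        using bij bij_betw_inv_into_left[OF bij] by (auto simp: bij_betw_def)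
    qed
    finally show ?thesis using img by simp
  qed
  moreover have "0 \<in> W" using bij \<eta> 0 by (metis bij_betw_apply centre_in_ball)
  ultimately have K_open: "open K"
    using open_cone_of_open_near_0[OF model_cones_scaleR[OF K] W] by blast
  define D where "D = frechet_derivative \<Psi> (at 0)"
  have D: "(\<Psi> has_derivative D) (at 0)"
    using d\<Psi> by (simp add: D_def frechet_derivative_works)
  have T_D: "T = D -` K" by (auto simp: T_eq D_def)
  show "open T"
    unfolding T_D using K_open
    by (rule open_vimage) (rule linear_continuous_on[OF has_derivative_bounded_linear[OF D]])
  show "\<forall>\<^sub>F \<epsilon> in at_right 0. \<epsilon> *\<^sub>R w \<in> U" if w: "w \<in> T"
  proof -
    have "((\<lambda>t. \<Psi> (t *\<^sub>R w)) has_derivative (\<lambda>t. D (t *\<^sub>R w))) (at 0)"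
      by (rule has_derivative_compose[where g=\<Psi> and f="\<lambda>t. t *\<^sub>R w"]) (auto intro!: derivative_eq_intros D)
    moreover have "D (t *\<^sub>R w) = t *\<^sub>R D w" for t
      using linear_cmul[OF has_derivative_linear[OF D]] .
    ultimately have "((\<lambda>t. \<Psi> (t *\<^sub>R w)) has_derivative (\<lambda>t. t *\<^sub>R D w)) (at_right 0)"
      by (simp add: has_derivative_at_withinI)
    then have "((\<lambda>t. norm (\<Psi> (t *\<^sub>R w) - t *\<^sub>R D w) / norm t) \<longlongrightarrow> 0) (at_right 0)"
      by (simp add: has_derivative_iff_norm 0)
    moreover have "\<forall>\<^sub>F t in at_right 0.
        norm (\<Psi> (t *\<^sub>R w) - t *\<^sub>R D w) / norm t = norm ((1 / t) *\<^sub>R \<Psi> (t *\<^sub>R w) - D w)"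
      using eventually_at_right_less[of "0::real"]
    proof eventually_elim
      case (elim t)
      have "(1 / t) *\<^sub>R \<Psi> (t *\<^sub>R w) - D w = (1 / t) *\<^sub>R (\<Psi> (t *\<^sub>R w) - t *\<^sub>R D w)"
        using elim by (simp add: scaleR_diff_right)
      then show ?case using elim by simp
    qed
    ultimately have "((\<lambda>t. norm ((1 / t) *\<^sub>R \<Psi> (t *\<^sub>R w) - D w)) \<longlongrightarrow> 0) (at_right 0)"
      by (rule Lim_transform_eventually)
    then have "((\<lambda>t. (1 / t) *\<^sub>R \<Psi> (t *\<^sub>R w)) \<longlongrightarrow> D w) (at_right 0)"
      by (simp add: tendsto_norm_zero_iff LIM_zero_iff)
    then have 1: "\<forall>\<^sub>F t in at_right 0. (1 / t) *\<^sub>R \<Psi> (t *\<^sub>R w) \<in> K"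
      using K_open w by (intro topological_tendstoD) (auto simp: T_D)
    have "((\<lambda>t. t *\<^sub>R w) \<longlongrightarrow> 0 *\<^sub>R w) (at_right 0)" by (intro tendsto_intros)
    then have 2: "\<forall>\<^sub>F t in at_right 0. t *\<^sub>R w \<in> ball 0 \<eta>"
      using \<eta> by (intro topological_tendstoD) auto
    show ?thesis
      using 1 2 eventually_at_right_less[of "0::real"]
    proof eventually_elim
      case (elim t)
      have "\<Psi> (t *\<^sub>R w) \<in> K"
        using model_cones_scaleR[OF K elim(1), of t] elim(3) by simp
      moreover have "\<Psi> (t *\<^sub>R w) \<in> W" using bij elim(2) by (meson bij_betw_apply)
      ultimately have "\<Psi> (t *\<^sub>R w) \<in> \<Psi> ` (U \<inter> ball 0 \<eta>)" using img by blast
      then obtain y where "y \<in> U" "y \<in> ball 0 \<eta>" "\<Psi> (t *\<^sub>R w) = \<Psi> y" by blast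
      then show ?case using bij elim(2) by (metis bij_betw_def inj_onD)
    qed
  qed
qed

text \<open>A point of the cone near the apex but outside \<open>U\<close> would yield a boundary point on its ray; the
  boundary being straight, the whole ray would then consist of boundary points near the apex, whereas
  it enters \<open>U\<close> there.\<close>

lemma straight_corner_contains_cone:
  assumes U: "open U" and straight: "sides_locally_straight U 0"
    and ray: "\<And>w. w \<in> T \<Longrightarrow> \<forall>\<^sub>F \<epsilon> in at_right 0. \<epsilon> *\<^sub>R w \<in> U"
  obtains \<rho> where "\<rho> > 0" "T \<inter> ball 0 \<rho> \<subseteq> U"
proof -
  from straight obtain \<rho> a b where \<rho>: "\<rho> > 0"
    and front: "frontier U \<inter> ball 0 \<rho> = {0 + t *\<^sub>R d | t d. 0 \<le> t \<and> t < \<rho> \<and> d \<in> {a, b}}"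
    unfolding sides_locally_straight_def by blast
  have disj: "x \<notin> frontier U" if "x \<in> U" for x
    using that U by (simp add: frontier_def interior_open)
  have "w \<in> U" if w: "w \<in> T" "w \<in> ball 0 \<rho>" for w
  proof (rule ccontr)
    assume notU: "w \<notin> U"
    have small: "\<forall>\<^sub>F t in at_right 0. t < e" if "e > 0" for e :: real
      using that by (auto simp: eventually_at_right_field)
    have ev: "\<forall>\<^sub>F t in at_right 0. t *\<^sub>R w \<in> U \<and> 0 < t \<and> t < e" if "e > 0" for e :: real
      using ray[OF w(1)] eventually_at_right_less[of "0::real"] small[OF that] by eventually_elim auto
    have ex: "\<exists>t. t *\<^sub>R w \<in> U \<and> 0 < t \<and> t < e" if "e > 0" for e :: real
      using eventually_happens'[OF _ ev[OF that]] by (auto simp: trivial_limit_at_right_real)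
    from ex[of 1] obtain t0 where t0: "t0 *\<^sub>R w \<in> U" "0 < t0" "t0 < 1" by auto
    have "closed_segment (t0 *\<^sub>R w) w \<inter> frontier U \<noteq> {}"
      using t0 notU by (intro connected_Int_frontier) auto
    then obtain z where z: "z \<in> closed_segment (t0 *\<^sub>R w) w" "z \<in> frontier U" by blast
    then obtain q where q: "z = (1 - q) *\<^sub>R (t0 *\<^sub>R w) + q *\<^sub>R w" "0 \<le> q" "q \<le> 1"
      by (auto simp: in_segment)
    define t1 where "t1 = (1 - q) * t0 + q"
    have z_eq: "z = t1 *\<^sub>R w" using q(1) by (simp add: t1_def algebra_simps)
    have t1: "t1 > 0" "t1 \<le> 1"
    proof -
      show "t1 > 0" using q t0 by (cases "q = 0") (auto simp: t1_def intro: add_nonneg_pos)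
      have "(1 - q) * t0 \<le> (1 - q) * 1" using q t0 by (intro mult_left_mono) auto
      then show "t1 \<le> 1" by (simp add: t1_def)
    qed
    \<comment> \<open>As t1 <= 1, the point z stays in the ball where the frontier is known to be
      straight.\<close>
    have "norm z < \<rho>"
      using w(2) t1 mult_left_le_one_le[of "norm w" t1] by (simp add: z_eq)
    then obtain t d where td: "z = t *\<^sub>R d" "0 \<le> t" "t < \<rho>" "d \<in> {a, b}"
      using front z(2) by fastforce
    from ex[of t1] t1 obtain e where e: "e *\<^sub>R w \<in> U" "0 < e" "e < t1" by blast
    have "e *\<^sub>R w = (e / t1) *\<^sub>R z" using t1 by (simp add: z_eq)
    also have "\<dots> = 0 + (e / t1 * t) *\<^sub>R d" using td(1) by simp
    finally have "e *\<^sub>R w = 0 + (e / t1 * t) *\<^sub>R d" .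
    \<comment> \<open>Since e < t1, the point e w lies between the apex and z, hence on the same
      boundary segment.\<close>
    moreover have "e / t1 * t \<le> t" using e t1 td by (intro mult_left_le_one_le) auto
    then have "0 \<le> e / t1 * t" "e / t1 * t < \<rho>" using e t1 td by auto
    ultimately have "e *\<^sub>R w \<in> frontier U \<inter> ball 0 \<rho>"
      unfolding front using td(4) by blast
    then show False using disj[OF e(1)] by blast
  qed
  then show ?thesis using that \<rho> by blast
qed

theorem proposition5p1:
  fixes \<Upsilon> :: "(real^2) set"
    and \<alpha> \<theta>\<^sub>0 :: real
    and \<phi> :: "real \<Rightarrow> real^2 \<Rightarrow> real"
    and u :: "real^2 \<Rightarrow> real"
  assumes "curvilinear_polygon \<Upsilon>" and "connected \<Upsilon>" and "bounded \<Upsilon>"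
    and "1 / 2 < \<alpha>" and "\<alpha> < 1" and "2 * \<theta>\<^sub>0 = pi / \<alpha>"
    and "reentrant_corners \<Upsilon> = {0}"
    and "corner_with_opening \<Upsilon> 0 (2 * \<theta>\<^sub>0)"
    and "sides_locally_straight \<Upsilon> 0"
    and "has_tangent_cone \<Upsilon> 0 (sector \<theta>\<^sub>0)"
    and "\<Upsilon> \<subseteq> sector \<theta>\<^sub>0"
    and "\<And>\<epsilon>. \<epsilon> > 0 \<Longrightarrow> dirichlet_solution \<Upsilon> (1 / \<epsilon>\<^sup>2) (\<phi> \<epsilon>)"
    and "minimal_solution (sector \<theta>\<^sub>0) u"
    and "\<xi> \<in> sector \<theta>\<^sub>0"
  shows "(\<forall>\<^sub>F \<epsilon> in at_right 0. \<epsilon> *\<^sub>R \<xi> \<in> \<Upsilon>) \<and>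
         ((\<lambda>\<epsilon>. \<phi> \<epsilon> (\<epsilon> *\<^sub>R \<xi>)) \<longlongrightarrow> u \<xi>) (at_right 0)"
proof -
  let ?S = "sector \<theta>\<^sub>0"
  have U: "open \<Upsilon>" using assms(1) by (simp add: curvilinear_polygon_def)
  note T = has_tangent_coneD[OF U assms(10)]
  \<comment> \<open>Tangency alone gives an inclusion ray by ray; the straight sides make the radius
    uniform over the sector.\<close>
  obtain \<rho> where \<rho>: "\<rho> > 0" "?S \<inter> ball 0 \<rho> \<subseteq> \<Upsilon>"
    using straight_corner_contains_cone[OF U assms(9) T(2)] by blast
  obtain D where D: "D > 0" "\<Upsilon> \<subseteq> ball 0 D"
    using bounded_subset_ballD[OF assms(3)] by blast
  obtain w where w: "\<And>R. R > 0 \<Longrightarrow> dirichlet_solution (?S \<inter> ball 0 R) 1 (w R)"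
    and u: "\<And>x. x \<in> ?S \<Longrightarrow> ereal (u x) = (SUP R\<in>{norm x<..}. ereal (w R x))"
    using assms(13) unfolding minimal_solution_def by blast
  define S where "S R = ?S \<inter> ball 0 R" for R
  have S_open: "open (S R)" for R using T(1) by (simp add: S_def open_Int)
  have w_sol: "H10_solution (S R) 1 (zero_extension (S R) (w R)) (zero_extension (S R) (weak_gradient (S R) (w R)))"
    and w_cont: "continuous_on (S R) (w R)" if "R > 0" for R
    using variational_solution_imp_H10_solution[OF S_open] w[OF that]
    by (auto simp: S_def dirichlet_solution_def)
  \<comment> \<open>Monotonicity of the truncated solutions lets a radius chosen for the supremum
    stay fixed while \<rho> / \<epsilon> grows past it.\<close>
  have w_mono: "w R \<xi> \<le> w R' \<xi>" if "norm \<xi> < R" "R \<le> R'" for R R'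
  proof -
    have "R > 0" "R' > 0" using that norm_ge_zero[of \<xi>] by linarith+
    then show ?thesis
      by (intro H10_solution_le_pointwise[OF S_open S_open _ _ w_sol w_sol w_cont w_cont])
         (use that assms(14) in \<open>auto simp: S_def\<close>)
  qed
  define Y where "Y \<epsilon> = {x. \<epsilon> *\<^sub>R x \<in> \<Upsilon>}" for \<epsilon>
  have Y_open: "open (Y \<epsilon>)" for \<epsilon>
  proof -
    have "Y \<epsilon> = (*\<^sub>R) \<epsilon> -` \<Upsilon>" by (auto simp: Y_def)
    then show ?thesis using U by (auto intro!: open_vimage continuous_intros)
  qed
  have \<phi>_sol: "\<exists>g. H10_solution (Y \<epsilon>) 1 (zero_extension (Y \<epsilon>) (\<lambda>x. \<phi> \<epsilon> (\<epsilon> *\<^sub>R x))) g"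
    and \<phi>_cont: "continuous_on (Y \<epsilon>) (\<lambda>x. \<phi> \<epsilon> (\<epsilon> *\<^sub>R x))" if "\<epsilon> > 0" for \<epsilon>
  proof -
    have sol: "variational_solution \<Upsilon> (1 / \<epsilon>\<^sup>2) (\<phi> \<epsilon>)" "continuous_on \<Upsilon> (\<phi> \<epsilon>)"
      using assms(12)[OF that] by (auto simp: dirichlet_solution_def)
    \<comment> \<open>Zero extension commutes with dilation, so the scaling of solutions applies
      directly.\<close>
    have "zero_extension (Y \<epsilon>) (\<lambda>x. \<phi> \<epsilon> (\<epsilon> *\<^sub>R x)) = (\<lambda>x. zero_extension \<Upsilon> (\<phi> \<epsilon>) (\<epsilon> *\<^sub>R x))"
      by (auto simp: zero_extension_def Y_def)
    then show "\<exists>g. H10_solution (Y \<epsilon>) 1 (zero_extension (Y \<epsilon>) (\<lambda>x. \<phi> \<epsilon> (\<epsilon> *\<^sub>R x))) g"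
      using H10_solution_scaleR[OF that variational_solution_imp_H10_solution[OF U sol(1)]] that
      by (auto simp: Y_def)
    show "continuous_on (Y \<epsilon>) (\<lambda>x. \<phi> \<epsilon> (\<epsilon> *\<^sub>R x))"
      by (rule continuous_on_compose2[OF sol(2)]) (auto intro!: continuous_intros simp: Y_def)
  qed
  have sub: "S (\<rho> / \<epsilon>) \<subseteq> Y \<epsilon>" "Y \<epsilon> \<subseteq> S (D / \<epsilon>)" if "\<epsilon> > 0" for \<epsilon>
  proof -
    show "S (\<rho> / \<epsilon>) \<subseteq> Y \<epsilon>"
      using \<rho>(2) sector_scaleR[OF _ that, of _ \<theta>\<^sub>0] that
      by (auto simp: S_def Y_def field_simps intro!: subsetD[OF \<rho>(2)])
    show "Y \<epsilon> \<subseteq> S (D / \<epsilon>)"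
    proof
      fix x assume "x \<in> Y \<epsilon>"
      then have "\<epsilon> *\<^sub>R x \<in> \<Upsilon>" by (simp add: Y_def)
      then have x: "\<epsilon> *\<^sub>R x \<in> ?S" "\<epsilon> *\<^sub>R x \<in> ball 0 D" using assms(11) D(2) by auto
      from sector_scaleR[OF x(1), of "1 / \<epsilon>"] that have "x \<in> ?S" by simp
      then show "x \<in> S (D / \<epsilon>)" using x(2) that by (simp add: S_def field_simps)
    qed
  qed
  have ev_R: "\<forall>\<^sub>F \<epsilon> in at_right 0. R < \<rho> / \<epsilon>" for R
  proof -
    \<comment> \<open>The denominator \<open>\<bar>R\<bar> + 1\<close> is positive for every real
      R.\<close>
    have "R < \<rho> / \<epsilon>" if \<epsilon>: "0 < \<epsilon>" "\<epsilon> < \<rho> / (\<bar>R\<bar> + 1)" for \<epsilon>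
    proof -
      have "\<bar>R\<bar> + 1 < \<rho> / \<epsilon>" using \<epsilon> by (simp add: field_simps)
      then show ?thesis by linarith
    qed
    then show ?thesis
      unfolding eventually_at_right_field
      using \<rho>(1) by (intro exI[of _ "\<rho> / (\<bar>R\<bar> + 1)"]) simp
  qed
  have sandwich: "w R \<xi> \<le> \<phi> \<epsilon> (\<epsilon> *\<^sub>R \<xi>)" "\<phi> \<epsilon> (\<epsilon> *\<^sub>R \<xi>) \<le> u \<xi>"
    if \<epsilon>: "\<epsilon> > 0" "norm \<xi> < R" "R < \<rho> / \<epsilon>" for \<epsilon> R
  proof -
    obtain g where g: "H10_solution (Y \<epsilon>) 1 (zero_extension (Y \<epsilon>) (\<lambda>x. \<phi> \<epsilon> (\<epsilon> *\<^sub>R x))) g"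
      using \<phi>_sol[OF \<epsilon>(1)] by blast
    have pos: "\<rho> / \<epsilon> > 0" "D / \<epsilon> > 0" using \<rho> D \<epsilon> by auto
    have \<xi>S: "\<xi> \<in> S (\<rho> / \<epsilon>)" using \<epsilon> assms(14) by (simp add: S_def)
    then have \<xi>Y: "\<xi> \<in> Y \<epsilon>" and "\<xi> \<in> S (D / \<epsilon>)" using sub[OF \<epsilon>(1)] by auto
    have "w R \<xi> \<le> w (\<rho> / \<epsilon>) \<xi>" using \<epsilon> by (intro w_mono) auto
    also have "\<dots> \<le> \<phi> \<epsilon> (\<epsilon> *\<^sub>R \<xi>)"
      by (rule H10_solution_le_pointwise[OF S_open Y_open sub(1) _ w_sol g w_cont \<phi>_cont \<xi>S])
         (use \<epsilon> pos in auto)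
    finally show "w R \<xi> \<le> \<phi> \<epsilon> (\<epsilon> *\<^sub>R \<xi>)" .
    have "\<phi> \<epsilon> (\<epsilon> *\<^sub>R \<xi>) \<le> w (D / \<epsilon>) \<xi>"
      by (rule H10_solution_le_pointwise[OF Y_open S_open sub(2) _ g w_sol \<phi>_cont w_cont \<xi>Y])
         (use \<epsilon> pos in auto)
    also have "w (D / \<epsilon>) \<xi> \<le> u \<xi>"
    proof -
      \<comment> \<open>Since \<xi> lies in the larger truncated sector,
        \<open>D / \<epsilon>\<close> exceeds its norm and is among the radii of the
        supremum.\<close>
      have "ereal (w (D / \<epsilon>) \<xi>) \<le> ereal (u \<xi>)"
        unfolding u[OF assms(14)] using \<open>\<xi> \<in> S (D / \<epsilon>)\<close> by (intro SUP_upper) (simp add: S_def)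
      then show ?thesis by simp
    qed
    finally show "\<phi> \<epsilon> (\<epsilon> *\<^sub>R \<xi>) \<le> u \<xi>" .
  qed
  have "((\<lambda>\<epsilon>. \<phi> \<epsilon> (\<epsilon> *\<^sub>R \<xi>)) \<longlongrightarrow> u \<xi>) (at_right 0)"
  proof (rule order_tendstoI)
    fix a assume "a < u \<xi>"
    then have "ereal a < (SUP R\<in>{norm \<xi><..}. ereal (w R \<xi>))"
      unfolding u[OF assms(14), symmetric] by simp
    \<comment> \<open>The radius is fixed before \<epsilon> tends to 0, so the lower bound
      \<open>w R \<xi>\<close> does not depend on \<epsilon>.\<close>
    then obtain R where R: "norm \<xi> < R" "a < w R \<xi>" by (auto simp: less_SUP_iff)
    show "\<forall>\<^sub>F \<epsilon> in at_right 0. a < \<phi> \<epsilon> (\<epsilon> *\<^sub>R \<xi>)"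
      using ev_R[of R] eventually_at_right_less[of "0::real"]
    proof eventually_elim
      case (elim \<epsilon>)
      then show ?case using sandwich(1)[of \<epsilon> R] R by simp
    qed
  next
    fix a assume a: "u \<xi> < a"
    show "\<forall>\<^sub>F \<epsilon> in at_right 0. \<phi> \<epsilon> (\<epsilon> *\<^sub>R \<xi>) < a"
      \<comment> \<open>The upper bound does not involve the radius, so any one beyond the norm of
        \<xi> will do.\<close>
      using ev_R[of "norm \<xi> + 1"] eventually_at_right_less[of "0::real"]
    proof eventually_elim
      case (elim \<epsilon>)
      then show ?case using sandwich(2)[of \<epsilon> "norm \<xi> + 1"] a by simp
    qed
  qed
  then show ?thesis using T(2)[OF assms(14)] by blast
qed

end
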